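(* $$\pi^3\, m\big((1+v)(1+w)(1+x)+(1-v)(1-w)(1-x)y\big)=7\pi\,\zeta(3)+4\sum_{0\le j<k}\frac{(-1)^j}{(2j+1)^2k^2},$$ where the polynomial is in the four variables $v,w,x,y$ and the sum is over pairs of integers $(j,k)$ with $0\le j<k$.
   Context: The (logarithmic) Mahler measure of a nonzero polynomial $P\in\mathbb{C}[x_1,\dots,x_n]$ is $m(P)=\frac{1}{(2\pi i)^n}\int_{\mathbb{T}^n}\log|P(x_1,\dots,x_n)|\,\frac{dx_1}{x_1}\cdots\frac{dx_n}{x_n}$, with $\mathbb{T}^n=\{|x_1|=\dots=|x_n|=1\}$. $\zeta$ is the Riemann zeta function. *)

theory Defs
  imports "HOL-Analysis.Analysis" "HOL-Library.Poly_Mapping"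
begin

(* A monomial is a finitely supported exponent vector and a polynomial a finitely supported
   family of coefficients, so the ring operations on this type are those of
   C[x_0, x_1, x_2, ...]. *)
type_synonym cpoly = "(nat \<Rightarrow>\<^sub>0 nat) \<Rightarrow>\<^sub>0 complex"

definition Var :: "nat \<Rightarrow> cpoly" where
  "Var i = Poly_Mapping.single (Poly_Mapping.single i 1) 1"

definition eval_poly :: "cpoly \<Rightarrow> (nat \<Rightarrow> complex) \<Rightarrow> complex" where
  "eval_poly P x =
     (\<Sum>m\<in>Poly_Mapping.keys P. Poly_Mapping.lookup P m *
        (\<Prod>i\<in>Poly_Mapping.keys m. x i ^ Poly_Mapping.lookup m i))"

(* Logarithmic Mahler measure of a nonzero polynomial in the n variables x_0, ..., x_(n-1).
   With x_k = exp(i t_k) one has dx_k / x_k = i dt_k, so the factor 1/(2 pi i)^n in front of the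
   integral over the torus becomes 1/(2 pi)^n. The library's ln 0 = 0 is harmless, since
   a nonzero polynomial vanishes on a null subset of the torus only. *)
definition mahler_measure :: "nat \<Rightarrow> cpoly \<Rightarrow> real" where
  "mahler_measure n P =
     (LINT t : PiE {..<n} (\<lambda>_. {0..2 * pi}) | PiM {..<n} (\<lambda>_. lborel).
        ln (cmod (eval_poly P (\<lambda>k. cis (t k))))) / (2 * pi) ^ n"

(* The Riemann zeta function on the half-line s > 1, where its Dirichlet series converges. *)
definition zeta :: "real \<Rightarrow> real" where
  "zeta s = suminf (\<lambda>n. 1 / real (Suc n) powr s)"

end

theory Submission
  imports Defs "HOL-Complex_Analysis.Complex_Analysis" "HOL-Probability.Distributions"
    "HOL-Real_Asymp.Real_Asymp"
begin

text \<open>Write \<open>v = cis a\<close>, \<open>w = cis b\<close>, \<open>x = cis c\<close>. Jensen's formula carries out the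
integration over \<open>y\<close>: the mean of \<open>ln |A + B y|\<close> over the circle is
\<open>max (ln |A|) (ln |B|) = ln |A| + max 0 (ln |B / A|)\<close>. Here \<open>A\<close> is the product of the \<open>1 + cis a\<close>, whose
logarithm has mean 0 (Jensen once more), and \<open>ln |B / A|\<close> is the sum of the three numbers
\<open>log_tan a = ln |tan (a / 2)|\<close>. For a uniform angle \<open>log_tan a\<close> has density \<open>sech u / pi\<close>
(lemma \<open>nn_integral_log_tan\<close>), so \<open>pi ^ 3\<close> times the Mahler measure is
the triple integral of \<open>max 0 (u + v + w) * sech u * sech v * sech w\<close> over the real space of dimension three.

The identity \<open>tanh u + tanh (s - u) = sinh s * sech u * sech (s - u)\<close> gives
\<open>sech * sech = 2 s / sinh s\<close> for the convolution (\<open>sech_conv_integral\<close>). Folding the even variable \<open>s = u + v\<close> to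
\<open>s > 0\<close>, and using \<open>max 0 t = t + max 0 (-t)\<close> and the symmetry of \<open>sech\<close>, the triple integral becomes
the integral over \<open>s > 0\<close> of \<open>2 s / sinh s * (pi * s + 2 * excess s)\<close>, where \<open>excess s\<close> is the
integral over \<open>w > 0\<close> of \<open>w * sech (w + s)\<close>.
Expanding \<open>1 / sinh\<close> and \<open>sech\<close> in powers of \<open>exp (-s)\<close> and integrating termwise, the first summand yields
\<open>7 pi zeta 3\<close>, the odd part of the zeta series. In the second, \<open>sech\<close> contributes the alternating
factor \<open>(-1)^j / (2 j + 1)^2\<close> and \<open>1 / sinh\<close> the squares \<open>1 / (m + j + 1)^2\<close>, which is the double sum with
\<open>k = m + j + 1 > j\<close>.

The function \<open>ln |P|\<close> is unbounded below on the torus, but \<open>4 ln 2 - ln |P|\<close> is nonnegative there because \<open>|P| \<le> 16\<close>.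
All integrals are therefore computed as nonnegative integrals of such differences, where Tonelli's theorem holds without
integrability conditions, and the value of the Bochner integral is read off at the end.\<close>

section \<open>Evaluation of polynomials\<close>

definition eval_monom :: "(nat \<Rightarrow>\<^sub>0 nat) \<Rightarrow> (nat \<Rightarrow> complex) \<Rightarrow> complex" where
  "eval_monom m x = (\<Prod>i\<in>Poly_Mapping.keys m. x i ^ Poly_Mapping.lookup m i)"

text \<open>Sums and products over the supports of two monomials or polynomials can only be combined over a common index set, hence this and the analogous lemma for polynomials.\<close>

lemma eval_monom_superset:
  assumes "finite S" "Poly_Mapping.keys m \<subseteq> S"
  shows "eval_monom m x = (\<Prod>i\<in>S. x i ^ Poly_Mapping.lookup m i)"
  unfolding eval_monom_def using assms
  by (intro prod.mono_neutral_left) (auto simp: in_keys_iff)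

lemma eval_monom_add: "eval_monom (m + n) x = eval_monom m x * eval_monom n x"
proof -
  let ?S = "Poly_Mapping.keys m \<union> Poly_Mapping.keys n"
  show ?thesis
    using Poly_Mapping.keys_add[of m n]
    by (simp add: eval_monom_superset[of ?S] lookup_add power_add prod.distrib)
qed

lemma eval_poly_superset:
  assumes "finite S" "Poly_Mapping.keys P \<subseteq> S"
  shows "eval_poly P x = (\<Sum>m\<in>S. Poly_Mapping.lookup P m * eval_monom m x)"
  unfolding eval_poly_def eval_monom_def[symmetric] using assms
  by (intro sum.mono_neutral_left) (auto simp: in_keys_iff)

lemma eval_poly_add: "eval_poly (P + Q) x = eval_poly P x + eval_poly Q x"
proof -
  let ?S = "Poly_Mapping.keys P \<union> Poly_Mapping.keys Q"
  show ?thesis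
    using Poly_Mapping.keys_add[of P Q]
    by (simp add: eval_poly_superset[of ?S] lookup_add distrib_right sum.distrib)
qed

lemma eval_poly_uminus: "eval_poly (- P) x = - eval_poly P x"
  using eval_poly_add[of P "-P" x] by (simp add: eval_poly_def[of 0] add_eq_0_iff2 minus_equation_iff)

lemma eval_poly_diff: "eval_poly (P - Q) x = eval_poly P x - eval_poly Q x"
  using eval_poly_add[of P "-Q" x] by (simp add: eval_poly_uminus)

lemma eval_poly_single: "eval_poly (Poly_Mapping.single m c) x = c * eval_monom m x"
  by (simp add: eval_poly_def eval_monom_def)

lemma eval_poly_one: "eval_poly 1 x = 1"
  using eval_poly_single[of 0 1 x] by (simp add: eval_monom_def)

lemma eval_poly_Var: "eval_poly (Var i) x = x i"
  by (simp add: Var_def eval_poly_single eval_monom_def)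

lemma poly_mapping_update_add:
  fixes f :: "'a \<Rightarrow>\<^sub>0 'b::comm_monoid_add"
  assumes "a \<notin> Poly_Mapping.keys f"
  shows "Poly_Mapping.update a b f = Poly_Mapping.single a b + f"
  using assms
  by (intro poly_mapping_eqI) (auto simp: lookup_update lookup_add lookup_single in_keys_iff when_def)

lemma eval_poly_mult_single:
  "eval_poly (Poly_Mapping.single m c * Q) x = eval_poly (Poly_Mapping.single m c) x * eval_poly Q x"
proof (induction Q rule: Poly_Mapping.update_induct)
  case const
  show ?case by (simp add: eval_poly_def)
next
  case (update Q n d)
  then show ?case
    by (simp add: poly_mapping_update_add distrib_left eval_poly_add mult_single eval_poly_single
          eval_monom_add algebra_simps)
qed

lemma eval_poly_mult: "eval_poly (P * Q) x = eval_poly P x * eval_poly Q x"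
proof (induction P rule: Poly_Mapping.update_induct)
  case const
  show ?case by (simp add: eval_poly_def)
next
  case (update P m c)
  then show ?case
    by (simp add: poly_mapping_update_add distrib_right eval_poly_add eval_poly_mult_single)
qed

section \<open>Jensen's formula on the unit circle\<close>

lemma norm_one_plus_cis_mult_le:
  assumes "cmod z \<le> 1" shows "cmod (1 + z * cis t) \<le> 2"
  using norm_triangle_ineq[of 1 "z * cis t"] assms by (simp add: norm_mult)

text \<open>For \<open>|z| < 1\<close> the function \<open>Ln (1 + z u)\<close> is holomorphic near the closed unit disc, and the mean over the circle of its real part is its value 0 at the centre.\<close>

lemma jensen_inside:
  assumes "cmod z < 1"
  shows "((\<lambda>t. ln (cmod (1 + z * cis t))) has_integral 0) {0..2 * pi}"
proof -
  let ?f = "\<lambda>u. Ln (1 + z * u)"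
  have re: "Re (1 + z * u) > 0" if "u \<in> cball 0 1" for u
  proof -
    have "cmod (z * u) < 1"
      using assms that mult_left_le[of "cmod u" "cmod z"] by (auto simp: norm_mult)
    then show ?thesis using abs_Re_le_cmod[of "z * u"] by simp
  qed
  have "?f holomorphic_on cball 0 1"
    using re by (intro holomorphic_intros) (auto dest!: complex_nonpos_Reals_iff[THEN iffD1] simp: not_less[symmetric])
  then have "((\<lambda>u. ?f u / (u - 0)) has_contour_integral (2 * of_real pi * \<i> * ?f 0)) (circlepath 0 1)"
    by (rule Cauchy_integral_circlepath_simple) simp
  then have "((\<lambda>t. ?f (cis t) * \<i>) has_integral 0) {0..2*pi}"
    by (simp add: circlepath_def has_contour_integral_part_circlepath_iff)
  from has_integral_mult_left[OF this, of "-\<i>"]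
  have "((\<lambda>t. ?f (cis t)) has_integral 0) {0..2*pi}" by (simp add: mult.assoc)
  then have "((\<lambda>t. Re (?f (cis t))) has_integral 0) {0..2*pi}"
    by (drule_tac has_integral_Re) simp
  moreover have "Re (?f (cis t)) = ln (cmod (1 + z * cis t))" for t
  proof -
    have "Re (1 + z * cis t) > 0" by (rule re) simp
    then have "1 + z * cis t \<noteq> 0" by (metis less_irrefl zero_complex.sel(1))
    then show ?thesis by (rule Re_Ln)
  qed
  ultimately show ?thesis by simp
qed

lemma nn_jensen_inside:
  assumes "cmod z < 1"
  shows "(\<integral>\<^sup>+t\<in>{0..2*pi}. ennreal (ln 2 - ln (cmod (1 + z * cis t))) \<partial>lborel) = ennreal (2 * pi * ln 2)"
proof (rule nn_integral_has_integral_lebesgue')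
  fix t :: real assume "t \<in> {0..2*pi}"
  have "1 + z * cis t \<noteq> 0"
    using assms by (metis add_eq_0_iff norm_cis norm_minus_cancel norm_mult norm_one mult.right_neutral less_irrefl)
  then show "0 \<le> ln 2 - ln (cmod (1 + z * cis t))"
    using norm_one_plus_cis_mult_le[of z t] assms by (simp)
next
  from has_integral_diff[OF has_integral_const_real[of "ln 2" 0 "2*pi"] jensen_inside[OF assms]]
  show "((\<lambda>t. ln 2 - ln (cmod (1 + z * cis t))) has_integral 2 * pi * ln 2) {0..2*pi}"
    by simp
qed

lemma borel_measurable_cis [measurable]: "cis \<in> borel_measurable borel"
  by (intro borel_measurable_continuous_onI continuous_intros)

lemma AE_cis_neq: "AE t in lborel. cis t \<noteq> c"
proof (cases "\<exists>t0. cis t0 = c")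
  case True
  then obtain t0 where t0: "cis t0 = c" by blast
  have "{t. cis t = c} \<subseteq> range (\<lambda>n::int. t0 + 2 * pi * of_int n)"
    using sin_cos_eq_iff[of _ t0] t0 by (auto simp: complex_eq_iff image_iff)
  then have "countable {t. cis t = c}"
    by (rule countable_subset) simp
  then have "{t. cis t = c} \<in> null_sets lborel"
    by (rule countable_imp_null_set_lborel)
  then show ?thesis by (rule AE_I') auto
qed auto

lemma AE_jensen_nonzero: "AE t in lborel. 1 + z * cis t \<noteq> 0"
  using AE_cis_neq[of "-1/z"]
proof eventually_elim
  case (elim t)
  then show ?case by (cases "z = 0") (auto simp: field_simps add_eq_0_iff)
qed

text \<open>On the boundary \<open>|z| = 1\<close> the integrand has a logarithmic singularity. It is approached by \<open>r z\<close> with \<open>r\<close> tending to 1: Fatou's lemma gives integrability, and then \<open>|1 + z cis t| \<le> 2 |1 + r z cis t|\<close> provides the dominating function for the limit.\<close>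

lemma nn_jensen_unit_disc:
  assumes "cmod z \<le> 1"
  shows "(\<integral>\<^sup>+t\<in>{0..2*pi}. ennreal (ln 2 - ln (cmod (1 + z * cis t))) \<partial>lborel) = ennreal (2 * pi * ln 2)"
proof -
  \<comment> \<open>Any sequence in the open unit interval with limit 1 would do.\<close>
  define r where "r n = 1 - 1 / real (n + 2)" for n
  have r: "0 \<le> r n" "r n < 1" for n by (auto simp: r_def)
  have r_lim: "r \<longlonglongrightarrow> 1"
    unfolding r_def by real_asymp
  define f where "f w t = ennreal (ln 2 - ln (cmod (1 + w * cis t))) * indicator {0..2*pi} t" for w t
  have [measurable]: "f w \<in> borel_measurable lborel" for w
    unfolding f_def by measurable
  have int_r: "(\<integral>\<^sup>+t. f (of_real (r n) * z) t \<partial>lborel) = ennreal (2 * pi * ln 2)" for n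
  proof -
    have "cmod (of_real (r n) * z) \<le> r n * 1"
      unfolding norm_mult using r[of n] assms by (intro mult_mono) auto
    with r[of n] show ?thesis unfolding f_def by (intro nn_jensen_inside) simp
  qed
  have lim: "AE t in lborel. (\<lambda>n. f (of_real (r n) * z) t) \<longlonglongrightarrow> f z t"
    using AE_jensen_nonzero[of z]
  proof eventually_elim
    case (elim t)
    have "(\<lambda>n. 1 + of_real (r n) * z * cis t) \<longlonglongrightarrow> 1 + of_real 1 * z * cis t"
      by (intro tendsto_intros r_lim)
    then have "(\<lambda>n. ln 2 - ln (cmod (1 + of_real (r n) * z * cis t))) \<longlonglongrightarrow> ln 2 - ln (cmod (1 + z * cis t))"
      using elim by (intro tendsto_diff tendsto_const tendsto_ln tendsto_norm) auto
    then show ?case unfolding f_def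
      by (cases "t \<in> {0..2*pi}") (simp_all add: tendsto_ennrealI)
  qed
  have le: "(\<integral>\<^sup>+t. f z t \<partial>lborel) \<le> ennreal (2 * pi * ln 2)"
  proof -
    have "(\<integral>\<^sup>+t. f z t \<partial>lborel) = (\<integral>\<^sup>+t. liminf (\<lambda>n. f (of_real (r n) * z) t) \<partial>lborel)"
      using lim by (intro nn_integral_cong_AE) (auto elim!: eventually_mono simp: lim_imp_Liminf)
    also have "\<dots> \<le> liminf (\<lambda>n. (\<integral>\<^sup>+t. f (of_real (r n) * z) t \<partial>lborel))"
      by (intro nn_integral_liminf) auto
    also have "\<dots> = ennreal (2 * pi * ln 2)"
      by (simp add: int_r Liminf_const)
    finally show ?thesis .
  qed
  have bound: "AE t in lborel. f (of_real (r n) * z) t \<le> f z t + ennreal (ln 2) * indicator {0..2*pi} t" for n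
    using AE_jensen_nonzero[of z]
  proof eventually_elim
    case (elim t)
    let ?a = "cmod (1 + z * cis t)" and ?b = "cmod (1 + of_real (r n) * z * cis t)"
    have zt: "cmod (z * cis t) \<le> 1" using assms by (simp add: norm_mult)
    have "?a = cmod ((1 + of_real (r n) * z * cis t) + (1 - of_real (r n)) * (z * cis t))"
      by (simp add: algebra_simps)
    also have "\<dots> \<le> ?b + cmod ((1 - of_real (r n)) * (z * cis t))"
      by (rule norm_triangle_ineq)
    also have "cmod ((1 - of_real (r n)) * (z * cis t)) \<le> 1 - r n"
    proof -
      have "cmod (1 - of_real (r n)) = 1 - r n"
        using r[of n] by (metis abs_of_nonneg diff_ge_0_iff_ge less_imp_le norm_of_real of_real_1 of_real_diff)
      then show ?thesis
        unfolding norm_mult[of "1 - _"] using r[of n] zt by (simp add: mult_left_le)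
    qed
    also have "1 - r n \<le> ?b"
    proof -
      have "cmod (of_real (r n) * z * cis t) \<le> r n"
        using r[of n] zt by (simp add: norm_mult mult_left_le)
      then show ?thesis using norm_triangle_ineq2[of 1 "- (of_real (r n) * z * cis t)"] by simp
    qed
    finally have ab: "?a \<le> 2 * ?b" by simp
    have "?a > 0" using elim by simp
    with ab have "?b > 0" by linarith
    have "ln ?a \<le> ln (2 * ?b)" using ab \<open>?a > 0\<close> by (subst ln_le_cancel_iff) auto
    also have "\<dots> = ln 2 + ln ?b" using \<open>?b > 0\<close> by (simp add: ln_mult)
    finally have "ln 2 - ln ?b \<le> (ln 2 - ln ?a) + ln 2" by simp
    moreover have "ln 2 - ln ?a \<ge> 0"
      using norm_one_plus_cis_mult_le[OF assms] \<open>?a > 0\<close> by simp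
    ultimately have "ennreal (ln 2 - ln ?b) \<le> ennreal (ln 2 - ln ?a) + ennreal (ln 2)"
      by (subst ennreal_plus[symmetric]) (auto intro: ennreal_leI)
    then show ?case unfolding f_def by (auto split: split_indicator)
  qed
  have "(\<lambda>n. \<integral>\<^sup>+t. f (of_real (r n) * z) t \<partial>lborel) \<longlonglongrightarrow> (\<integral>\<^sup>+t. f z t \<partial>lborel)"
  proof (rule nn_integral_dominated_convergence[OF _ _ _ bound _ lim])
    have "(\<integral>\<^sup>+t. f z t + ennreal (ln 2) * indicator {0..2*pi} t \<partial>lborel)
        = (\<integral>\<^sup>+t. f z t \<partial>lborel) + ennreal (ln 2) * ennreal (2 * pi)"
      by (subst nn_integral_add) (auto simp: nn_integral_cmult_indicator)
    also have "\<dots> \<le> ennreal (2 * pi * ln 2) + ennreal (ln 2) * ennreal (2 * pi)"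
      using le by (rule add_right_mono)
    also have "\<dots> < \<infinity>" by (simp add: ennreal_mult_less_top)
    finally show "(\<integral>\<^sup>+t. f z t + ennreal (ln 2) * indicator {0..2*pi} t \<partial>lborel) < \<infinity>" .
  qed auto
  then have "(\<integral>\<^sup>+t. f z t \<partial>lborel) = ennreal (2 * pi * ln 2)"
    by (simp add: int_r LIMSEQ_const_iff)
  then show ?thesis by (simp add: f_def)
qed

text \<open>The constant \<open>c\<close> exceeds every value of the logarithm, so the integrand splits into two nonnegative parts.\<close>

lemma nn_jensen_shift:
  assumes z: "cmod z \<le> 1" and c: "ln 2 + ln d \<le> c" and d: "d > 0"
  shows "(\<integral>\<^sup>+t\<in>{0..2*pi}. ennreal (c - ln (d * cmod (1 + z * cis t))) \<partial>lborel)
       = ennreal (2 * pi * (c - ln d))"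
proof -
  have "(\<integral>\<^sup>+t\<in>{0..2*pi}. ennreal (c - ln (d * cmod (1 + z * cis t))) \<partial>lborel)
      = (\<integral>\<^sup>+t. ennreal (c - ln d - ln 2) * indicator {0..2*pi} t
              + ennreal (ln 2 - ln (cmod (1 + z * cis t))) * indicator {0..2*pi} t \<partial>lborel)"
  proof (rule nn_integral_cong_AE)
    show "AE t in lborel. ennreal (c - ln (d * cmod (1 + z * cis t))) * indicator {0..2*pi} t
        = ennreal (c - ln d - ln 2) * indicator {0..2*pi} t
          + ennreal (ln 2 - ln (cmod (1 + z * cis t))) * indicator {0..2*pi} t"
      using AE_jensen_nonzero[of z]
    proof eventually_elim
      case (elim t)
      then have "ln 2 - ln (cmod (1 + z * cis t)) \<ge> 0"
        using norm_one_plus_cis_mult_le[OF z] by simp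
      moreover have "c - ln (d * cmod (1 + z * cis t))
          = (c - ln d - ln 2) + (ln 2 - ln (cmod (1 + z * cis t)))"
        using elim d by (simp add: ln_mult)
      ultimately show ?case using c
        by (simp only: ennreal_plus diff_ge_0_iff_ge distrib_right le_diff_eq add.commute)
    qed
  qed
  also have "\<dots> = ennreal (c - ln d - ln 2) * ennreal (2 * pi) + ennreal (2 * pi * ln 2)"
    by (subst nn_integral_add) (auto simp: nn_integral_cmult_indicator nn_jensen_unit_disc[OF z])
  also have "\<dots> = ennreal ((c - ln d - ln 2) * (2 * pi) + 2 * pi * ln 2)"
    using c by (subst ennreal_plus) (auto simp: ennreal_mult)
  also have "(c - ln d - ln 2) * (2 * pi) + 2 * pi * ln 2 = 2 * pi * (c - ln d)"
    by (simp add: algebra_simps)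
  finally show ?thesis .
qed

text \<open>The larger of \<open>A\<close> and \<open>B\<close> is factored out. If this is \<open>B\<close>, conjugation on the circle turns \<open>A / (B y) + 1\<close> into the conjugate of \<open>1 + cnj (A / B) y\<close>.\<close>

lemma nn_jensen_linear:
  assumes "A \<noteq> 0" "B \<noteq> 0" and c: "ln 2 + max (ln (cmod A)) (ln (cmod B)) \<le> c"
  shows "(\<integral>\<^sup>+t\<in>{0..2*pi}. ennreal (c - ln (cmod (A + B * cis t))) \<partial>lborel)
       = ennreal (2 * pi * (c - max (ln (cmod A)) (ln (cmod B))))"
proof (cases "cmod B \<le> cmod A")
  case True
  have "cmod (A + B * cis t) = cmod A * cmod (1 + B / A * cis t)" for t
    using assms(1) by (simp add: norm_mult[symmetric] distrib_left)
  moreover have "max (ln (cmod A)) (ln (cmod B)) = ln (cmod A)"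
    using True assms by (simp add: max_def)
  ultimately show ?thesis
    using nn_jensen_shift[of "B / A" "cmod A" c] True assms by (simp add: norm_divide)
next
  case False
  have "cmod (A + B * cis t) = cmod B * cmod (1 + cnj (A / B) * cis t)" for t
  proof -
    have "A + B * cis t = B * cis t * cnj (1 + cnj (A / B) * cis t)"
      using assms by (simp add: cis_cnj field_simps cis_mult)
    then show ?thesis by (simp only: norm_mult complex_mod_cnj norm_cis mult_1_right)
  qed
  moreover have "max (ln (cmod A)) (ln (cmod B)) = ln (cmod B)"
    using False assms by (simp add: max_def)
  ultimately show ?thesis
    using nn_jensen_shift[of "cnj (A / B)" "cmod B" c] False assms by (simp add: norm_divide)
qed

section \<open>The distribution of the logarithm of the tangent\<close>

definition sech :: "real \<Rightarrow> real" where "sech u = 1 / cosh u"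

text \<open>Since \<open>|1 - cis a| = 2 |sin (a / 2)|\<close> and \<open>|1 + cis a| = 2 |cos (a / 2)|\<close>, this is \<open>ln |tan (a / 2)|\<close>.\<close>

definition log_tan :: "real \<Rightarrow> real" where
  "log_tan a = ln (cmod (1 - cis a)) - ln (cmod (1 + cis a))"

lemma sech_pos: "sech u > 0" by (simp add: sech_def)
lemma sech_minus: "sech (- u) = sech u" by (simp add: sech_def)

lemma sech_eq_exp: "sech u = 2 * exp u / (1 + exp u ^ 2)"
  by (simp add: sech_def cosh_def exp_minus field_simps power2_eq_square)

lemma continuous_on_sech [continuous_intros]: "continuous_on S sech"
  unfolding sech_def by (intro continuous_intros) auto

lemma borel_measurable_sech [measurable]: "sech \<in> borel_measurable borel"
  by (intro borel_measurable_continuous_onI continuous_intros)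

lemma borel_measurable_log_tan [measurable]: "log_tan \<in> borel_measurable borel"
  unfolding log_tan_def by measurable

lemma log_tan_arctan_exp: "log_tan (2 * arctan (exp u)) = u"
proof -
  let ?x = "exp u"
  have pos: "1 + ?x\<^sup>2 > 0" by (simp add: add_pos_pos)
  have c: "cos (2 * arctan ?x) = (1 - ?x\<^sup>2) / (1 + ?x\<^sup>2)"
    unfolding cos_double cos_arctan sin_arctan using pos by (simp add: power_divide field_simps)
  have s: "sin (2 * arctan ?x) = 2 * ?x / (1 + ?x\<^sup>2)"
    unfolding sin_double cos_arctan sin_arctan using pos by (simp add: power_divide field_simps)
  let ?t = "1 + \<i> * of_real ?x"
  have ne: "?t \<noteq> 0" by (simp add: complex_eq_iff)
  have cis: "cis (2 * arctan ?x) = ?t\<^sup>2 / of_real (1 + ?x\<^sup>2)"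
    by (simp add: complex_eq_iff c s power2_eq_square Re_divide_of_real Im_divide_of_real)
  \<comment> \<open>The half-angle formula \<open>cis (2 arctan x) = (1 + i x) / (1 - i x)\<close>.\<close>
  have r: "of_real (1 + ?x\<^sup>2) = ?t * (1 - \<i> * of_real ?x)"
    by (simp add: complex_eq_iff power2_eq_square)
  have cis': "cis (2 * arctan ?x) = ?t / (1 - \<i> * of_real ?x)"
    unfolding cis r using ne by (simp add: power2_eq_square)
  have d: "1 - \<i> * of_real ?x \<noteq> 0" by (simp add: complex_eq_iff)
  have "1 - cis (2 * arctan ?x) = of_real ?x * (- 2 * \<i> / (1 - \<i> * of_real ?x))"
    unfolding cis' using d by (simp add: field_simps)
  moreover have "1 + cis (2 * arctan ?x) = 2 / (1 - \<i> * of_real ?x)"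
    unfolding cis' using d by (simp add: field_simps)
  ultimately show ?thesis
    using d unfolding log_tan_def by (simp only: norm_mult norm_divide) (simp add: ln_mult ln_div)
qed

lemma log_tan_reflect: "log_tan (2 * pi - a) = log_tan a"
proof -
  have c: "cis (2 * pi - a) = cnj (cis a)"
    by (simp add: complex_eq_iff)
  have "1 - cnj (cis a) = cnj (1 - cis a)" "1 + cnj (cis a) = cnj (1 + cis a)" by simp_all
  then show ?thesis unfolding log_tan_def c by (simp only: complex_mod_cnj)
qed

text \<open>The substitution \<open>a = 2 arctan (exp u)\<close> has derivative \<open>sech u\<close> and inverts \<open>log_tan\<close>. It is carried out on the compact intervals from \<open>-n\<close> to \<open>n\<close>, which exhaust both sides monotonically.\<close>

lemma nn_integral_log_tan_half:
  assumes [measurable]: "F \<in> borel_measurable borel"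
  shows "(\<integral>\<^sup>+a\<in>{0<..<pi}. F (log_tan a) \<partial>lborel) = (\<integral>\<^sup>+u. F u * ennreal (sech u) \<partial>lborel)"
proof -
  let ?g = "\<lambda>u::real. 2 * arctan (exp u)"
  have deriv: "(?g has_real_derivative sech x) (at x)" for x
    unfolding sech_eq_exp by (rule derivative_eq_intros refl | simp add: divide_inverse mult_ac)+
  have eq: "(\<integral>\<^sup>+a. F (log_tan a) * indicator {?g (- real n)..?g (real n)} a \<partial>lborel)
      = (\<integral>\<^sup>+u. F u * ennreal (sech u) * indicator {- real n..real n} u \<partial>lborel)" if "n > 0" for n
  proof -
    have "(\<integral>\<^sup>+a. F (log_tan a) * indicator {?g (- real n)..?g (real n)} a \<partial>lborel)
        = (\<integral>\<^sup>+u. F (log_tan (?g u)) * ennreal (sech u) * indicator {- real n..real n} u \<partial>lborel)"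
      by (rule nn_integral_substitution_aux[of "\<lambda>a. F (log_tan a)" _ _ ?g sech, OF _ _ deriv])
         (use that in \<open>simp_all add: continuous_on_sech less_imp_le[OF sech_pos]\<close>)
    then show ?thesis by (simp only: log_tan_arctan_exp)
  qed
  have lim1: "(\<lambda>n. \<integral>\<^sup>+a. F (log_tan a) * indicator {?g (- real n)..?g (real n)} a \<partial>lborel)
      \<longlonglongrightarrow> (\<integral>\<^sup>+a. F (log_tan a) * indicator {0<..<pi} a \<partial>lborel)"
  proof (rule nn_integral_LIMSEQ)
    show "incseq (\<lambda>n a. F (log_tan a) * indicator {?g (- real n)..?g (real n)} a)"
    proof (rule incseq_SucI, rule le_funI)
      fix n a
      have "{?g (- real n)..?g (real n)} \<subseteq> {?g (- real (Suc n))..?g (real (Suc n))}"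
        by (subst atLeastatMost_subset_iff) (simp add: arctan_le_iff)
      then show "F (log_tan a) * indicator {?g (- real n)..?g (real n)} a
          \<le> F (log_tan a) * indicator {?g (- real (Suc n))..?g (real (Suc n))} a"
        by (intro mult_left_mono) (auto split: split_indicator)
    qed
    fix a
    have gt: "?g u > 0" "?g u < pi" for u
      using arctan_ubound[of "exp u"] by auto
    show "(\<lambda>n. F (log_tan a) * indicator {?g (- real n)..?g (real n)} a)
        \<longlonglongrightarrow> F (log_tan a) * indicator {0<..<pi} a"
    proof (cases "a \<in> {0<..<pi}")
      case True
      have l0: "(\<lambda>n. exp (- real n)) \<longlonglongrightarrow> 0" and l1: "filterlim (\<lambda>n. exp (real n)) at_top sequentially"
        by real_asymp+
      have "(\<lambda>n. ?g (- real n)) \<longlonglongrightarrow> 2 * arctan 0"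
        by (intro tendsto_mult tendsto_const tendsto_arctan l0)
      then have "eventually (\<lambda>n. ?g (- real n) < a) sequentially"
        by (rule order_tendstoD) (use True in simp)
      moreover have "(\<lambda>n. ?g (real n)) \<longlonglongrightarrow> 2 * (pi / 2)"
        by (intro tendsto_mult tendsto_const filterlim_compose[OF tendsto_arctan_at_top l1])
      then have "eventually (\<lambda>n. a < ?g (real n)) sequentially"
        by (rule order_tendstoD) (use True in simp)
      ultimately have "eventually (\<lambda>n. F (log_tan a) * indicator {?g (- real n)..?g (real n)} a
          = F (log_tan a) * indicator {0<..<pi} a) sequentially"
        by eventually_elim (use True in auto)
      then show ?thesis by (rule tendsto_eventually)
    next
      case False
      then have "a \<notin> {?g (- real n)..?g (real n)}" for n
        using gt(1)[of "- real n"] gt(2)[of "real n"]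
        unfolding atLeastAtMost_iff greaterThanLessThan_iff by linarith
      with False show ?thesis by simp
    qed
  qed auto
  have lim2: "(\<lambda>n. \<integral>\<^sup>+u. F u * ennreal (sech u) * indicator {- real n..real n} u \<partial>lborel)
      \<longlonglongrightarrow> (\<integral>\<^sup>+u. F u * ennreal (sech u) \<partial>lborel)"
  proof (rule nn_integral_LIMSEQ)
    show "incseq (\<lambda>n u. F u * ennreal (sech u) * indicator {- real n..real n} u)"
      by (rule incseq_SucI) (auto simp: le_fun_def split: split_indicator)
    fix u :: real
    obtain N where "\<bar>u\<bar> \<le> real N" using real_arch_simple by blast
    have "eventually (\<lambda>n. F u * ennreal (sech u) * indicator {- real n..real n} u = F u * ennreal (sech u)) sequentially"
      using eventually_ge_at_top[of N]
    proof eventually_elim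
      case (elim n)
      with \<open>\<bar>u\<bar> \<le> real N\<close> have "u \<in> {- real n..real n}" by simp linarith
      then show ?case by simp
    qed
    then show "(\<lambda>n. F u * ennreal (sech u) * indicator {- real n..real n} u) \<longlonglongrightarrow> F u * ennreal (sech u)"
      by (rule tendsto_eventually)
  qed auto
  have ev: "eventually (\<lambda>n. (\<integral>\<^sup>+a. F (log_tan a) * indicator {?g (- real n)..?g (real n)} a \<partial>lborel)
      = (\<integral>\<^sup>+u. F u * ennreal (sech u) * indicator {- real n..real n} u \<partial>lborel)) sequentially"
    using eventually_gt_at_top[of 0] by eventually_elim (rule eq)
  show ?thesis
    by (rule LIMSEQ_unique[OF Lim_transform_eventually[OF lim1 ev] lim2])
qed

text \<open>The halves of the circle are exchanged by \<open>a \<mapsto> 2 pi - a\<close>, under which \<open>log_tan\<close> is invariant.\<close>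

lemma nn_integral_log_tan:
  assumes [measurable]: "F \<in> borel_measurable borel"
  shows "(\<integral>\<^sup>+a\<in>{0..2*pi}. F (log_tan a) \<partial>lborel) = 2 * (\<integral>\<^sup>+u. F u * ennreal (sech u) \<partial>lborel)"
proof -
  have "{0, pi, 2 * pi :: real} \<in> null_sets lborel"
    by (intro countable_imp_null_set_lborel) simp
  then have "AE a in lborel. a \<notin> {0, pi, 2 * pi :: real}"
    by (rule AE_not_in)
  then have ae: "AE a in lborel. F (log_tan a) * indicator {0..2*pi} a
      = F (log_tan a) * indicator {0<..<pi} a + F (log_tan a) * indicator {pi<..<2*pi} a"
  proof eventually_elim
    case (elim a)
    then have "a \<in> {0..2*pi} \<longleftrightarrow> a \<in> {0<..<pi} \<or> a \<in> {pi<..<2*pi}"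
      using pi_gt_zero unfolding greaterThanLessThan_iff atLeastAtMost_iff insert_iff empty_iff by linarith
    moreover have "\<not> (a \<in> {0<..<pi} \<and> a \<in> {pi<..<2*pi})"
      unfolding greaterThanLessThan_iff by linarith
    ultimately show ?case
      by (cases "a \<in> {0<..<pi}"; cases "a \<in> {pi<..<2*pi}") (simp_all only: indicator_def simp_thms of_bool_eq mult_zero_right mult_1_right add_0_left add_0_right)
  qed
  have "(\<integral>\<^sup>+a\<in>{0..2*pi}. F (log_tan a) \<partial>lborel)
      = (\<integral>\<^sup>+a\<in>{0<..<pi}. F (log_tan a) \<partial>lborel) + (\<integral>\<^sup>+a\<in>{pi<..<2*pi}. F (log_tan a) \<partial>lborel)"
    by (subst nn_integral_cong_AE[OF ae], rule nn_integral_add) auto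
  also have "(\<integral>\<^sup>+a\<in>{pi<..<2*pi}. F (log_tan a) \<partial>lborel) = (\<integral>\<^sup>+a\<in>{0<..<pi}. F (log_tan a) \<partial>lborel)"
  proof -
    have mem: "2 * pi - a \<in> {pi<..<2*pi} \<longleftrightarrow> a \<in> {0<..<pi}" for a
      unfolding greaterThanLessThan_iff by linarith
    have ind: "(indicator {pi<..<2*pi} (2 * pi - a) :: ennreal) = indicator {0<..<pi} a" for a
      by (simp only: indicator_def mem)
    have "(\<integral>\<^sup>+a\<in>{pi<..<2*pi}. F (log_tan a) \<partial>lborel)
        = ennreal \<bar>-1\<bar> * (\<integral>\<^sup>+a. F (log_tan (2 * pi + -1 * a)) * indicator {pi<..<2*pi} (2 * pi + -1 * a) \<partial>lborel)"
      by (rule nn_integral_real_affine) auto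
    then show ?thesis by (simp add: log_tan_reflect ind)
  qed
  finally show ?thesis
    unfolding nn_integral_log_tan_half[OF assms] mult_2 .
qed

section \<open>Integrals and series of hyperbolic functions\<close>

text \<open>By \<open>tanh u + tanh (s - u) = sinh s * sech u * sech (s - u)\<close> the integrand has the primitive \<open>(ln cosh u - ln cosh (u - s)) / sinh s\<close>, with limits \<open>s / sinh s\<close> and \<open>- s / sinh s\<close> at the two ends.\<close>

lemma sech_conv_integral:
  assumes s: "s \<noteq> 0"
  shows "(\<integral>\<^sup>+u. ennreal (sech u * sech (s - u)) \<partial>lborel) = ennreal (2 * s / sinh s)"
proof -
  let ?F = "\<lambda>u. (ln (cosh u) - ln (cosh (u - s))) / sinh s"
  let ?f = "\<lambda>u. sech u * sech (s - u)"
  have sh: "sinh s \<noteq> 0" using s by simp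
  have deriv: "(?F has_real_derivative ?f u) (at u)" for u
  proof -
    have c: "cosh (u - s) = cosh (s - u)" by (metis cosh_minus minus_diff_eq)
    have d: "sinh (u - s) = - sinh (s - u)" by (metis sinh_minus minus_diff_eq)
    have S: "sinh s = sinh u * cosh (s - u) + cosh u * sinh (s - u)"
      using sinh_add[of u "s - u"] by simp
    have "sinh u / cosh u + sinh (s - u) / cosh (s - u)
        = (sinh u * cosh (s - u) + cosh u * sinh (s - u)) / (cosh u * cosh (s - u))"
      by (simp add: add_frac_eq mult.commute)
    then have "sinh u / cosh u - sinh (u - s) / cosh (u - s) = sinh s / (cosh u * cosh (s - u))"
      unfolding c d S by simp
    then have "(sinh u / cosh u - sinh (u - s) / cosh (u - s)) / sinh s = ?f u"
      using sh by (simp add: sech_def)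
    moreover have "(?F has_real_derivative (sinh u / cosh u - sinh (u - s) / cosh (u - s)) / sinh s) (at u)"
      using sh by (auto intro!: derivative_eq_intros simp: cosh_real_pos divide_inverse)
    ultimately show ?thesis by simp
  qed
  have top: "(?F \<longlongrightarrow> s / sinh s) at_top"
  proof -
    have "((\<lambda>u. ln (cosh u) - ln (cosh (u - s))) \<longlongrightarrow> s) at_top"
      unfolding cosh_field_def by (real_asymp, simp add: ln_div)
    then show ?thesis by (intro tendsto_divide tendsto_const sh)
  qed
  have bot: "(?F \<longlongrightarrow> - s / sinh s) at_bot"
  proof -
    have "((\<lambda>u. ln (cosh u) - ln (cosh (u - s))) \<longlongrightarrow> - s) at_bot"
      unfolding cosh_field_def by (real_asymp, simp add: ln_div)
    then show ?thesis by (intro tendsto_divide tendsto_const sh)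
  qed
  have cont: "isCont ?f u" for u
    by (intro continuous_on_interior[of UNIV] continuous_intros
        continuous_on_compose2[OF continuous_on_sech]) auto
  have pos: "?f u \<ge> 0" for u
    by (simp add: less_imp_le[OF sech_pos])
  have int: "set_integrable lborel (einterval (-\<infinity>) \<infinity>) ?f"
    and eq: "(LBINT u=-\<infinity>..\<infinity>. ?f u) = s / sinh s - (- s / sinh s)"
    using deriv cont pos top bot
    by (intro interval_integral_FTC_nonneg[where F = ?F]; simp add: ereal_tendsto_simps1)+
  have UNIV: "einterval (-\<infinity>) \<infinity> = (UNIV :: real set)"
    by (auto simp: einterval_def)
  have "integrable lborel ?f" "integral\<^sup>L lborel ?f = 2 * s / sinh s"
    using int eq unfolding set_integrable_def UNIV
    by (simp_all add: interval_lebesgue_integral_def set_lebesgue_integral_def UNIV add_divide_distrib[symmetric])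
  then show ?thesis
    using pos by (subst nn_integral_eq_integral) auto
qed

text \<open>This is the total length of the circle, transported by \<open>log_tan\<close>.\<close>

lemma nn_integral_sech: "(\<integral>\<^sup>+u. ennreal (sech u) \<partial>lborel) = ennreal pi"
proof -
  have "2 * (\<integral>\<^sup>+u. 1 * ennreal (sech u) \<partial>lborel) = (\<integral>\<^sup>+a\<in>{0..2*pi}. 1 \<partial>lborel)"
    by (rule nn_integral_log_tan[symmetric]) simp
  also have "\<dots> = 2 * ennreal pi"
    by (simp add: ennreal_mult)
  finally show ?thesis
    by (simp add: ennreal_mult_cancel_left)
qed

lemma nn_integral_power_exp:
  assumes l: "l > (0::real)"
  shows "(\<integral>\<^sup>+x\<in>{0<..}. ennreal (x ^ k * exp (- (l * x))) \<partial>lborel) = ennreal (fact k / l ^ (k + 1))"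
proof -
  have "(\<integral>\<^sup>+x\<in>{0<..}. ennreal (x ^ k * exp (- (l * x))) \<partial>lborel)
      = ennreal \<bar>1 / l\<bar> * (\<integral>\<^sup>+y. ennreal ((0 + 1 / l * y) ^ k * exp (- (l * (0 + 1 / l * y))))
            * indicator {0<..} (0 + 1 / l * y) \<partial>lborel)"
    by (rule nn_integral_real_affine) (use l in auto)
  also have "(\<integral>\<^sup>+y. ennreal ((0 + 1 / l * y) ^ k * exp (- (l * (0 + 1 / l * y))))
            * indicator {0<..} (0 + 1 / l * y) \<partial>lborel)
      = (\<integral>\<^sup>+y. ennreal (1 / l ^ k) * (ennreal (y ^ k * exp (- y)) * indicator {0..} y) \<partial>lborel)"
  proof (rule nn_integral_cong_AE)
    show "AE y in lborel. ennreal ((0 + 1 / l * y) ^ k * exp (- (l * (0 + 1 / l * y))))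
            * indicator {0<..} (0 + 1 / l * y)
        = ennreal (1 / l ^ k) * (ennreal (y ^ k * exp (- y)) * indicator {0..} y)"
      using AE_lborel_singleton[of 0]
    proof eventually_elim
      case (elim y)
      have "0 + 1 / l * y \<in> {0<..} \<longleftrightarrow> y \<in> {0..}"
        using l elim by (auto simp: zero_less_divide_iff)
      then have ind: "(indicator {0<..} (0 + 1 / l * y) :: ennreal) = indicator {0..} y"
        by (simp only: indicator_def)
      have val: "(0 + 1 / l * y) ^ k * exp (- (l * (0 + 1 / l * y))) = 1 / l ^ k * (y ^ k * exp (- y))"
        using l by (simp add: power_divide)
      show ?case
        unfolding ind val using l by (subst ennreal_mult') (simp_all add: mult.assoc)
    qed
  qed
  also have "\<dots> = ennreal (1 / l ^ k) * ennreal (fact k)"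
    by (subst nn_integral_cmult) (auto simp: nn_intergal_power_times_exp_Ici)
  also have "ennreal \<bar>1 / l\<bar> * \<dots> = ennreal (fact k / l ^ (k + 1))"
    using l by (simp add: ennreal_mult'[symmetric])
  finally show ?thesis .
qed

text \<open>Geometric series for \<open>2 exp (-x) / (1 + exp (-2 x))\<close>; it converges absolutely only for \<open>x > 0\<close>.\<close>

lemma sech_sums:
  assumes "x > 0"
  shows "(\<lambda>j. 2 * (-1) ^ j * exp (- ((2 * real j + 1) * x))) sums sech x"
proof -
  have "(\<lambda>j. (- exp (- (2 * x))) ^ j) sums (1 / (1 - (- exp (- (2 * x)))))"
    using assms by (intro geometric_sums) simp
  from sums_mult[OF this, of "2 * exp (- x)"]
  have "(\<lambda>j. 2 * exp (- x) * (- exp (- (2 * x))) ^ j) sums (2 * exp (- x) * (1 / (1 + exp (- (2 * x)))))"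
    by simp
  moreover have "2 * exp (- x) * (- exp (- (2 * x))) ^ j = 2 * (-1) ^ j * exp (- ((2 * real j + 1) * x))" for j
  proof -
    have "(- exp (- (2 * x))) ^ j = (-1) ^ j * exp (- (2 * real j * x))"
      by (subst power_minus) (simp add: exp_of_nat_mult[symmetric] mult_ac)
    moreover have "exp (- ((2 * real j + 1) * x)) = exp (- x) * exp (- (2 * real j * x))"
      by (simp add: exp_add[symmetric] algebra_simps)
    ultimately show ?thesis by simp
  qed
  moreover have "2 * exp (- x) * (1 / (1 + exp (- (2 * x)))) = sech x"
  proof -
    have "exp (- (2 * x)) = exp (- x) * exp (- x)" by (simp add: exp_add[symmetric])
    then show ?thesis by (simp add: sech_def cosh_def exp_minus field_simps)
  qed
  ultimately show ?thesis by simp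
qed

lemma inverse_sinh_sums:
  assumes "x > 0"
  shows "(\<lambda>m. 2 * exp (- ((2 * real m + 1) * x))) sums (1 / sinh x)"
proof -
  have "(\<lambda>j. exp (- (2 * x)) ^ j) sums (1 / (1 - exp (- (2 * x))))"
    using assms by (intro geometric_sums) simp
  from sums_mult[OF this, of "2 * exp (- x)"]
  have "(\<lambda>j. 2 * exp (- x) * exp (- (2 * x)) ^ j) sums (2 * exp (- x) * (1 / (1 - exp (- (2 * x)))))"
    by simp
  moreover have "2 * exp (- x) * exp (- (2 * x)) ^ j = 2 * exp (- ((2 * real j + 1) * x))" for j
  proof -
    have "exp (- (2 * x)) ^ j = exp (- (2 * real j * x))"
      by (simp add: exp_of_nat_mult[symmetric] mult_ac)
    moreover have "exp (- ((2 * real j + 1) * x)) = exp (- x) * exp (- (2 * real j * x))"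
      by (simp add: exp_add[symmetric] algebra_simps)
    ultimately show ?thesis by simp
  qed
  moreover have "2 * exp (- x) * (1 / (1 - exp (- (2 * x)))) = 1 / sinh x"
  proof -
    have e: "exp (- (2 * x)) = exp (- x) * exp (- x)" by (simp add: exp_add[symmetric])
    have E: "2 * inverse E * (1 / (1 - inverse E * inverse E)) = 1 / ((E - inverse E) / 2)"
      if "E * E > 1 * 1" "E > 0" for E :: real
      using that by (simp add: field_simps)
    have "exp x * exp x > 1 * 1"
      using assms by (intro mult_strict_mono) auto
    from E[OF this exp_gt_zero] show ?thesis unfolding e unfolding sinh_field_def exp_minus .
  qed
  ultimately show ?thesis by simp
qed

section \<open>The series for zeta 3 and for the double sum\<close>

lemma summable_inverse_power_Suc:
  "k \<ge> 2 \<Longrightarrow> summable (\<lambda>n. 1 / real (Suc n) ^ k)"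
  using inverse_power_summable[of k, where 'a = real]
  by (subst summable_Suc_iff) (simp add: inverse_eq_divide)

lemma summable_inverse_odd_power:
  assumes "k \<ge> 2"
  shows "summable (\<lambda>j. 1 / (2 * real j + 1) ^ k)"
  by (rule summable_comparison_test'[OF summable_inverse_power_Suc[OF assms], of 0])
     (auto intro!: divide_left_mono power_mono mult_pos_pos)

lemma summable_inverse_square_shift: "summable (\<lambda>m. 1 / (real (m + j + 1))\<^sup>2)"
  using summable_iff_shift[of "\<lambda>m. 1 / (real (Suc m))\<^sup>2" j] summable_inverse_power_Suc[of 2]
  by (simp add: add_ac)

text \<open>The tail of the series for \<open>zeta 2\<close> over \<open>k > j\<close>, that is, the inner sum of the double sum with \<open>k = m + j + 1\<close>.\<close>

definition tail_zeta2 :: "nat \<Rightarrow> real" where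
  "tail_zeta2 j = (suminf (\<lambda>m. 1 / (real (m + j + 1))\<^sup>2))"

lemma tail_zeta2_nonneg: "tail_zeta2 j \<ge> 0"
  unfolding tail_zeta2_def by (intro suminf_nonneg summable_inverse_square_shift) simp

lemma tail_zeta2_le: "tail_zeta2 j \<le> tail_zeta2 0"
  unfolding tail_zeta2_def
  by (intro suminf_le summable_inverse_square_shift)
     (auto intro!: divide_left_mono power_mono mult_pos_pos)

text \<open>The termwise integration of \<open>1 / sinh\<close> that is common to the two integrals below; all terms are nonnegative.\<close>

lemma nn_integral_csch_series:
  assumes g: "\<And>m::nat. (\<integral>\<^sup>+s\<in>{0<..}. ennreal (g s * exp (- ((2 * real m + 1) * s))) \<partial>lborel) = ennreal (c m)"
    and c: "summable c" "\<And>m. c m \<ge> 0"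
    and gnn: "\<And>s. s > 0 \<Longrightarrow> g s \<ge> 0" and [measurable]: "g \<in> borel_measurable borel"
  shows "(\<integral>\<^sup>+s\<in>{0<..}. ennreal (g s / sinh s) \<partial>lborel) = ennreal (2 * (suminf (\<lambda>m. c m)))"
proof -
  have "(\<integral>\<^sup>+s\<in>{0<..}. ennreal (g s / sinh s) \<partial>lborel)
      = (\<integral>\<^sup>+s. (suminf (\<lambda>m. 2 * (ennreal (g s * exp (- ((2 * real m + 1) * s))) * indicator {0<..} s))) \<partial>lborel)"
  proof (rule nn_integral_cong)
    fix s :: real
    show "ennreal (g s / sinh s) * indicator {0<..} s
        = (suminf (\<lambda>m. 2 * (ennreal (g s * exp (- ((2 * real m + 1) * s))) * indicator {0<..} s)))"
    proof (cases "s > 0")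
      case True
      have "(\<lambda>m. g s * (2 * exp (- ((2 * real m + 1) * s)))) sums (g s * (1 / sinh s))"
        by (rule sums_mult[OF inverse_sinh_sums[OF True]])
      then have "(suminf (\<lambda>m. ennreal (g s * (2 * exp (- ((2 * real m + 1) * s)))))) = ennreal (g s / sinh s)"
        using gnn[OF True] by (subst suminf_ennreal2) (auto simp: sums_iff)
      moreover have "ennreal (g s * (2 * exp (- ((2 * real m + 1) * s))))
          = 2 * ennreal (g s * exp (- ((2 * real m + 1) * s)))" for m
      proof -
        have "g s * (2 * exp (- ((2 * real m + 1) * s))) = 2 * (g s * exp (- ((2 * real m + 1) * s)))" by simp
        then show ?thesis by (simp only: ennreal_mult' ennreal_numeral zero_le_numeral)
      qed
      ultimately show ?thesis using True by simp
    qed simp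
  qed
  also have "\<dots> = (suminf (\<lambda>m. 2 * ennreal (c m)))"
    by (subst nn_integral_suminf, measurable) (subst nn_integral_cmult, auto simp: g)
  also have "\<dots> = 2 * ennreal (suminf (\<lambda>m. c m))"
    using c by (simp add: suminf_ennreal2)
  also have "\<dots> = ennreal (2 * (suminf (\<lambda>m. c m)))"
    by (simp add: ennreal_mult')
  finally show ?thesis .
qed

lemma nn_integral_csch_exp:
  "(\<integral>\<^sup>+s\<in>{0<..}. ennreal (s / sinh s * exp (- ((2 * real j + 1) * s))) \<partial>lborel) = ennreal (tail_zeta2 j / 2)"
proof -
  have "(\<integral>\<^sup>+s\<in>{0<..}. ennreal (s * exp (- ((2 * real j + 1) * s)) / sinh s) \<partial>lborel)
      = ennreal (2 * (suminf (\<lambda>m. 1 / 4 * (1 / (real (m + j + 1))\<^sup>2))))"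
  proof (rule nn_integral_csch_series)
    fix m :: nat
    have "s * exp (- ((2 * real j + 1) * s)) * exp (- ((2 * real m + 1) * s))
        = s ^ 1 * exp (- ((2 * real (m + j + 1)) * s))" for s
      by (simp add: mult.assoc exp_add[symmetric] algebra_simps)
    then have "(\<integral>\<^sup>+s\<in>{0<..}. ennreal (s * exp (- ((2 * real j + 1) * s)) * exp (- ((2 * real m + 1) * s))) \<partial>lborel)
        = (\<integral>\<^sup>+s\<in>{0<..}. ennreal (s ^ 1 * exp (- ((2 * real (m + j + 1)) * s))) \<partial>lborel)"
      by (simp only:)
    also have "\<dots> = ennreal (fact 1 / (2 * real (m + j + 1)) ^ (1 + 1))"
      by (rule nn_integral_power_exp) simp
    also have "fact 1 / (2 * real (m + j + 1)) ^ (1 + 1) = 1 / 4 * (1 / (real (m + j + 1))\<^sup>2)"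
      by (simp add: power2_eq_square algebra_simps)
    finally show "(\<integral>\<^sup>+s\<in>{0<..}. ennreal (s * exp (- ((2 * real j + 1) * s)) * exp (- ((2 * real m + 1) * s))) \<partial>lborel)
        = ennreal (1 / 4 * (1 / (real (m + j + 1))\<^sup>2))" .
  qed (use summable_mult[OF summable_inverse_square_shift[of j], of "1 / 4"] in simp_all)
  also have "2 * (suminf (\<lambda>m. 1 / 4 * (1 / (real (m + j + 1))\<^sup>2))) = tail_zeta2 j / 2"
    unfolding tail_zeta2_def by (subst suminf_mult[OF summable_inverse_square_shift]) simp
  finally show ?thesis by simp
qed

text \<open>The even terms of the zeta series contribute one eighth of the whole.\<close>

lemma zeta_3_odd: "(suminf (\<lambda>m. 1 / (2 * real m + 1) ^ 3)) = 7 / 8 * zeta 3"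
proof -
  let ?f = "\<lambda>n. 1 / real (Suc n) ^ 3"
  have sm: "summable ?f"
    by (rule summable_inverse_power_Suc) simp
  have z: "zeta 3 = (suminf (\<lambda>n. ?f n))"
    unfolding zeta_def by (simp add: powr_numeral)
  have so: "summable (\<lambda>m. 1 / (2 * real m + 1) ^ 3)"
    by (rule summable_inverse_odd_power) simp
  have "?f sums zeta 3" unfolding z using sm by (rule summable_sums)
  then have "(\<lambda>n. sum ?f {n * 2..<n * 2 + 2}) sums zeta 3"
    by (rule sums_group) simp
  moreover have "sum ?f {n * 2..<n * 2 + 2} = 1 / (2 * real n + 1) ^ 3 + 1 / 8 * ?f n" for n
  proof -
    have "{n * 2..<n * 2 + 2} = {n * 2, Suc (n * 2)}" by auto
    moreover have "real (Suc (Suc (n * 2))) ^ 3 = 8 * real (Suc n) ^ 3"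
      by (simp add: power3_eq_cube algebra_simps)
    ultimately show ?thesis by (simp add: mult.commute add.commute)
  qed
  ultimately have "(\<lambda>n. 1 / (2 * real n + 1) ^ 3 + 1 / 8 * ?f n) sums zeta 3" by simp
  moreover have "(\<lambda>n. 1 / (2 * real n + 1) ^ 3 + 1 / 8 * ?f n) sums
      ((suminf (\<lambda>m. 1 / (2 * real m + 1) ^ 3)) + 1 / 8 * zeta 3)"
    unfolding z by (intro sums_add sums_mult summable_sums so sm)
  ultimately have "zeta 3 = (suminf (\<lambda>m. 1 / (2 * real m + 1) ^ 3)) + 1 / 8 * zeta 3"
    by (rule sums_unique2)
  then show "(suminf (\<lambda>m. 1 / (2 * real m + 1) ^ 3)) = 7 / 8 * zeta 3" by simp
qed

lemma nn_integral_csch_square: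
  "(\<integral>\<^sup>+s\<in>{0<..}. ennreal (s ^ 2 / sinh s) \<partial>lborel) = ennreal (7 / 2 * zeta 3)"
proof -
  have "(\<integral>\<^sup>+s\<in>{0<..}. ennreal (s ^ 2 / sinh s) \<partial>lborel) = ennreal (2 * (suminf (\<lambda>m. 2 * (1 / (2 * real m + 1) ^ 3))))"
  proof (rule nn_integral_csch_series)
    fix m :: nat
    have "0 < 2 * real m + 1" by simp
    from nn_integral_power_exp[OF this, of 2]
    show "(\<integral>\<^sup>+s\<in>{0<..}. ennreal (s ^ 2 * exp (- ((2 * real m + 1) * s))) \<partial>lborel)
        = ennreal (2 * (1 / (2 * real m + 1) ^ 3))"
      by (simp add: fact_numeral)
  qed (use summable_mult[OF summable_inverse_odd_power, of 3 2] in simp_all)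
  also have "2 * (suminf (\<lambda>m. 2 * (1 / (2 * real m + 1) ^ 3))) = 7 / 2 * zeta 3"
    by (subst suminf_mult[OF summable_inverse_odd_power]) (simp_all add: zeta_3_odd)
  finally show ?thesis .
qed

text \<open>Termwise integration of the series of \<open>sech\<close>. The terms alternate, so the interchange uses absolute convergence: the integrals of the absolute values are bounded by \<open>2 / (2 j + 1)^2\<close>.\<close>

lemma excess_series:
  assumes s: "s > 0"
  shows "integrable lborel (\<lambda>w. indicator {0<..} w * (w * sech (w + s)))" (is ?I)
    and "(\<lambda>j. 2 * (-1) ^ j * exp (- ((2 * real j + 1) * s)) / (2 * real j + 1)\<^sup>2) sums
         (\<integral>w. indicator {0<..} w * (w * sech (w + s)) \<partial>lborel)" (is ?S)
proof -
  define f where "f j w = indicator {0<..} w * (w * (2 * (-1) ^ j * exp (- ((2 * real j + 1) * (w + s)))))"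
    for j :: nat and w :: real
  define d where "d j = 2 * exp (- ((2 * real j + 1) * s)) / (2 * real j + 1)\<^sup>2" for j :: nat
  have mono: "has_bochner_integral lborel
      (\<lambda>w. indicator {0<..} w * (w * exp (- ((2 * real j + 1) * w)))) (1 / (2 * real j + 1)\<^sup>2)" for j :: nat
  proof (rule has_bochner_integral_nn_integral)
    show "AE w in lborel. 0 \<le> indicator {0<..} w * (w * exp (- ((2 * real j + 1) * w)))"
      by (auto split: split_indicator)
    have "0 < 2 * real j + 1" by simp
    from nn_integral_power_exp[OF this, of 1]
    have "(\<integral>\<^sup>+w\<in>{0<..}. ennreal (w * exp (- ((2 * real j + 1) * w))) \<partial>lborel)
        = ennreal (1 / (2 * real j + 1)\<^sup>2)"
      by (simp add: power2_eq_square)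
    moreover have "(\<integral>\<^sup>+w\<in>{0<..}. ennreal (w * exp (- ((2 * real j + 1) * w))) \<partial>lborel)
        = (\<integral>\<^sup>+w. ennreal (indicator {0<..} w * (w * exp (- ((2 * real j + 1) * w)))) \<partial>lborel)"
      by (intro nn_integral_cong) (auto split: split_indicator)
    ultimately show "(\<integral>\<^sup>+w. ennreal (indicator {0<..} w * (w * exp (- ((2 * real j + 1) * w)))) \<partial>lborel)
        = ennreal (1 / (2 * real j + 1)\<^sup>2)"
      by simp
  qed auto
  have f_eq: "f j w = (2 * (-1) ^ j * exp (- ((2 * real j + 1) * s))) *
      (indicator {0<..} w * (w * exp (- ((2 * real j + 1) * w))))" for j w
  proof -
    have "exp (- ((2 * real j + 1) * (w + s))) = exp (- ((2 * real j + 1) * s)) * exp (- ((2 * real j + 1) * w))"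
      by (simp add: exp_add[symmetric] algebra_simps)
    then show ?thesis unfolding f_def by simp
  qed
  have f_norm: "norm (f j w) = (2 * exp (- ((2 * real j + 1) * s))) *
      (indicator {0<..} w * (w * exp (- ((2 * real j + 1) * w))))" for j w
    unfolding f_eq by (simp add: abs_mult power_abs split: split_indicator)
  have hb: "has_bochner_integral lborel (f j) ((-1) ^ j * d j)" for j
    using has_bochner_integral_mult_right[OF mono[of j], of "2 * (-1) ^ j * exp (- ((2 * real j + 1) * s))"]
    unfolding f_eq[abs_def] d_def by (simp add: mult_ac)
  have hbn: "has_bochner_integral lborel (\<lambda>w. norm (f j w)) (d j)" for j
    using has_bochner_integral_mult_right[OF mono[of j], of "2 * exp (- ((2 * real j + 1) * s))"]
    unfolding f_norm[abs_def] d_def by simp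
  have intf: "integrable lborel (f j)" for j using hb[of j] by (rule integrable.intros)
  have sumd: "summable d"
  proof (rule summable_comparison_test')
    show "summable (\<lambda>j. 2 * (1 / (2 * real j + 1)\<^sup>2))" by (intro summable_mult summable_inverse_odd_power) simp
    show "norm (d j) \<le> 2 * (1 / (2 * real j + 1)\<^sup>2)" if "j \<ge> 0" for j
      using s by (simp add: d_def divide_right_mono)
  qed
  have sumf: "(\<lambda>j. f j w) sums (indicator {0<..} w * (w * sech (w + s)))" for w
  proof (cases "w > 0")
    case True
    then have "w + s > 0" using s by simp
    from sums_mult[OF sums_mult[OF sech_sums[OF this], of w], of "indicator {0<..} w"]
    show ?thesis unfolding f_def .
  qed (simp add: f_def)
  have sumn: "summable (\<lambda>j. norm (f j w))" for w
  proof -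
    have "summable (\<lambda>j. exp (- (2 * s)) ^ j)" using s by (intro summable_geometric) simp
    then have "summable (\<lambda>j. 2 * exp (- s) * (indicator {0<..} w * w) * exp (- (2 * s)) ^ j)" by (rule summable_mult)
    then show ?thesis
    proof (rule summable_comparison_test'[where N = 0])
      fix j :: nat
      have "exp (- ((2 * real j + 1) * s)) = exp (- s) * exp (- (2 * s)) ^ j"
        by (simp add: exp_of_nat_mult[symmetric] exp_add[symmetric] algebra_simps)
      then have "norm (f j w) = 2 * exp (- s) * exp (- (2 * s)) ^ j * (indicator {0<..} w * w) * exp (- ((2 * real j + 1) * w))"
        unfolding f_norm by simp
      also have "\<dots> \<le> 2 * exp (- s) * exp (- (2 * s)) ^ j * (indicator {0<..} w * w) * 1"
        by (cases "w > 0") (auto intro!: mult_left_mono)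
      finally show "norm (norm (f j w)) \<le> 2 * exp (- s) * (indicator {0<..} w * w) * exp (- (2 * s)) ^ j"
        by (simp add: mult_ac)
    qed
  qed
  have sumni: "summable (\<lambda>j. \<integral>w. norm (f j w) \<partial>lborel)"
    using sumd hbn[THEN has_bochner_integral_integral_eq] by simp
  have eq: "(suminf (\<lambda>j. f j w)) = indicator {0<..} w * (w * sech (w + s))" for w
    using sumf[of w] by (simp add: sums_iff)
  show ?I using integrable_suminf[OF intf _ sumni] sumn unfolding eq by simp
  have "(\<lambda>j. integral\<^sup>L lborel (f j)) sums (\<integral>w. indicator {0<..} w * (w * sech (w + s)) \<partial>lborel)"
    using sums_integral[OF intf _ sumni] sumn unfolding eq by simp
  then show ?S
    unfolding hb[THEN has_bochner_integral_integral_eq] d_def by (simp add: mult.assoc mult.left_commute)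
qed

text \<open>Up to the factor \<open>pi\<close>, the mean of \<open>max 0 (U - s)\<close> for a variable \<open>U\<close> with density \<open>sech / pi\<close>, written with the shifted variable \<open>w = u - s\<close>.\<close>

definition excess :: "real \<Rightarrow> real" where
  "excess s = (\<integral>w. indicator {0<..} w * (w * sech (w + s)) \<partial>lborel)"

lemma excess_nonneg: "excess s \<ge> 0"
  unfolding excess_def
  by (intro integral_nonneg_AE) (auto simp: less_imp_le[OF sech_pos] split: split_indicator)

lemma borel_measurable_excess [measurable]: "excess \<in> borel_measurable borel"
  unfolding excess_def[abs_def] by measurable

text \<open>The double sum of the theorem, summed over \<open>k\<close> first.\<close>

definition double_sum :: real where
  "double_sum = suminf (\<lambda>j. (-1) ^ j / (2 * real j + 1)\<^sup>2 * tail_zeta2 j)"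

lemma summable_abs_double_sum: "summable (\<lambda>j. 1 / (2 * real j + 1)\<^sup>2 * tail_zeta2 j)"
proof (rule summable_comparison_test'[where N = 0])
  show "summable (\<lambda>j. tail_zeta2 0 * (1 / (2 * real j + 1)\<^sup>2))"
    by (intro summable_mult summable_inverse_odd_power) simp
  show "norm (1 / (2 * real j + 1)\<^sup>2 * tail_zeta2 j) \<le> tail_zeta2 0 * (1 / (2 * real j + 1)\<^sup>2)" for j
    using tail_zeta2_le[of j] tail_zeta2_nonneg[of j] by (simp add: divide_right_mono)
qed

lemma borel_measurable_sinh [measurable]: "(sinh :: real \<Rightarrow> real) \<in> borel_measurable borel"
  by (intro borel_measurable_continuous_onI continuous_intros)

text \<open>Inserting the series of \<open>excess s\<close> leaves for each \<open>j\<close> the integral of \<open>nn_integral_csch_exp\<close>. The terms alternate in sign; absolute convergence comes from \<open>summable_abs_double_sum\<close>.\<close>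

lemma nn_integral_csch_excess:
  shows "(\<integral>\<^sup>+s\<in>{0<..}. ennreal (s / sinh s * excess s) \<partial>lborel) = ennreal double_sum"
    and double_sum_nonneg: "double_sum \<ge> 0"
proof -
  define f where "f j s = indicator {0<..} s * (s / sinh s *
      (2 * (-1) ^ j * exp (- ((2 * real j + 1) * s)) / (2 * real j + 1)\<^sup>2))" for j :: nat and s :: real
  have csch_nonneg: "s / sinh s \<ge> 0" if "s > 0" for s :: real
    using that by simp
  have mono: "has_bochner_integral lborel
      (\<lambda>s. indicator {0<..} s * (s / sinh s * exp (- ((2 * real j + 1) * s)))) (tail_zeta2 j / 2)" for j :: nat
  proof (rule has_bochner_integral_nn_integral)
    show "AE s in lborel. 0 \<le> indicator {0<..} s * (s / sinh s * exp (- ((2 * real j + 1) * s)))"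
      by (auto split: split_indicator)
    have "(\<integral>\<^sup>+s. ennreal (indicator {0<..} s * (s / sinh s * exp (- ((2 * real j + 1) * s)))) \<partial>lborel)
        = (\<integral>\<^sup>+s\<in>{0<..}. ennreal (s / sinh s * exp (- ((2 * real j + 1) * s))) \<partial>lborel)"
      by (intro nn_integral_cong) (auto split: split_indicator)
    then show "(\<integral>\<^sup>+s. ennreal (indicator {0<..} s * (s / sinh s * exp (- ((2 * real j + 1) * s)))) \<partial>lborel)
        = ennreal (tail_zeta2 j / 2)"
      by (simp only: nn_integral_csch_exp)
  qed (use tail_zeta2_nonneg in auto)
  have f_eq: "f j s = (2 * (-1) ^ j / (2 * real j + 1)\<^sup>2) *
      (indicator {0<..} s * (s / sinh s * exp (- ((2 * real j + 1) * s))))" for j s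
    unfolding f_def by (simp add: mult_ac)
  have f_norm: "norm (f j s) = (2 / (2 * real j + 1)\<^sup>2) *
      (indicator {0<..} s * (s / sinh s * exp (- ((2 * real j + 1) * s))))" for j s
    unfolding f_eq by (simp add: abs_mult power_abs split: split_indicator)
  have hb: "has_bochner_integral lborel (f j) ((-1) ^ j / (2 * real j + 1)\<^sup>2 * tail_zeta2 j)" for j
    using has_bochner_integral_mult_right[OF mono[of j], of "2 * (-1) ^ j / (2 * real j + 1)\<^sup>2"]
    unfolding f_eq[abs_def] by simp
  have hbn: "has_bochner_integral lborel (\<lambda>s. norm (f j s)) (1 / (2 * real j + 1)\<^sup>2 * tail_zeta2 j)" for j
    using has_bochner_integral_mult_right[OF mono[of j], of "2 / (2 * real j + 1)\<^sup>2"]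
    unfolding f_norm[abs_def] by simp
  have intf: "integrable lborel (f j)" for j using hb[of j] by (rule integrable.intros)
  have sumni: "summable (\<lambda>j. \<integral>s. norm (f j s) \<partial>lborel)"
    unfolding hbn[THEN has_bochner_integral_integral_eq] by (rule summable_abs_double_sum)
  have sumn: "summable (\<lambda>j. norm (f j s))" for s
  proof (cases "s > 0")
    case True
    have "summable (\<lambda>j. (2 * (s / sinh s)) * (1 / (2 * real j + 1)\<^sup>2))"
      by (intro summable_mult summable_inverse_odd_power) simp
    then show ?thesis
    proof (rule summable_comparison_test'[where N = 0])
      fix j :: nat
      have "s / sinh s * exp (- ((2 * real j + 1) * s)) \<le> s / sinh s"
        using True by (intro mult_left_le) auto
      then have "2 / (2 * real j + 1)\<^sup>2 * (s / sinh s * exp (- ((2 * real j + 1) * s)))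
          \<le> 2 / (2 * real j + 1)\<^sup>2 * (s / sinh s)"
        by (rule mult_left_mono) simp
      moreover have "norm (norm (f j s)) = 2 / (2 * real j + 1)\<^sup>2 * (s / sinh s * exp (- ((2 * real j + 1) * s)))"
        unfolding f_norm using True by simp
      ultimately show "norm (norm (f j s)) \<le> (2 * (s / sinh s)) * (1 / (2 * real j + 1)\<^sup>2)"
        by (simp add: mult_ac)
    qed
  qed (simp add: f_def)
  have sumf: "suminf (\<lambda>j. f j s) = indicator {0<..} s * (s / sinh s * excess s)" for s
  proof (cases "s > 0")
    case True
    from sums_mult[OF sums_mult[OF excess_series(2)[OF True], of "s / sinh s"], of "indicator {0<..} s"]
    show ?thesis unfolding f_def excess_def by (simp add: sums_iff)
  qed (simp add: f_def)
  have int: "integrable lborel (\<lambda>s. indicator {0<..} s * (s / sinh s * excess s))"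
    using integrable_suminf[OF intf _ sumni] sumn unfolding sumf by simp
  have val: "(\<integral>s. indicator {0<..} s * (s / sinh s * excess s) \<partial>lborel) = double_sum"
    using integral_suminf[OF intf _ sumni] sumn
    unfolding sumf hb[THEN has_bochner_integral_integral_eq] double_sum_def by simp
  show "double_sum \<ge> 0"
    unfolding val[symmetric] by (intro integral_nonneg_AE) (auto simp: excess_nonneg split: split_indicator)
  have "(\<integral>\<^sup>+s\<in>{0<..}. ennreal (s / sinh s * excess s) \<partial>lborel)
      = (\<integral>\<^sup>+s. ennreal (indicator {0<..} s * (s / sinh s * excess s)) \<partial>lborel)"
    by (intro nn_integral_cong) (auto split: split_indicator)
  also have "\<dots> = ennreal double_sum"
    unfolding val[symmetric]
    by (rule nn_integral_eq_integral[OF int]) (auto simp: excess_nonneg split: split_indicator)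
  finally show "(\<integral>\<^sup>+s\<in>{0<..}. ennreal (s / sinh s * excess s) \<partial>lborel) = ennreal double_sum" .
qed

text \<open>Absolute summability over the pairs reduces the unordered sum to the iterated one.\<close>

lemma double_sum_infsum:
  "(\<Sum>\<^sub>\<infinity>(j, k) \<in> {(j, k). j < k}. (-1) ^ j / ((2 * real j + 1)\<^sup>2 * (real k)\<^sup>2)) = double_sum"
proof -
  let ?g = "\<lambda>(j, k). (-1) ^ j / ((2 * real j + 1)\<^sup>2 * (real k)\<^sup>2)"
  let ?h = "\<lambda>j k. (-1) ^ j / ((2 * real j + 1)\<^sup>2 * (real k)\<^sup>2)"
  have eqS: "{(j, k). j < k} = Sigma (UNIV :: nat set) (\<lambda>j. {j<..})" by auto
  have bij: "bij_betw (\<lambda>m. m + j + 1) (UNIV :: nat set) {j<..}" for j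
    by (rule bij_betwI[where g = "\<lambda>k. k - j - 1"]) auto
  have tail: "((\<lambda>k. 1 / (real k)\<^sup>2) has_sum tail_zeta2 j) {j<..}" for j
  proof -
    have "((\<lambda>m. 1 / (real (m + j + 1))\<^sup>2) has_sum tail_zeta2 j) UNIV"
      unfolding tail_zeta2_def
      by (intro norm_summable_imp_has_sum summable_sums) (use summable_inverse_square_shift[of j] in simp_all)
    then show ?thesis
      by (simp add: has_sum_reindex_bij_betw[OF bij, of "\<lambda>k. 1 / (real k)\<^sup>2", symmetric])
  qed
  have inner: "(?h j has_sum ((-1) ^ j / (2 * real j + 1)\<^sup>2 * tail_zeta2 j)) {j<..}" for j
    using has_sum_cmult_right[OF tail[of j], of "(-1) ^ j / (2 * real j + 1)\<^sup>2"] by simp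
  have inner_abs: "((\<lambda>k. norm (?h j k)) has_sum (1 / (2 * real j + 1)\<^sup>2 * tail_zeta2 j)) {j<..}" for j
    using has_sum_cmult_right[OF tail[of j], of "1 / (2 * real j + 1)\<^sup>2"]
    by (simp add: abs_mult power_abs)
  have "(\<lambda>p. norm (?g p)) summable_on Sigma UNIV (\<lambda>j. {j<..})"
  proof (rule summable_on_SigmaI[where g = "\<lambda>j. 1 / (2 * real j + 1)\<^sup>2 * tail_zeta2 j"])
    show "((\<lambda>k. norm (?g (j, k))) has_sum (1 / (2 * real j + 1)\<^sup>2 * tail_zeta2 j)) {j<..}" for j
      using inner_abs[of j] by simp
    show "(\<lambda>j. 1 / (2 * real j + 1)\<^sup>2 * tail_zeta2 j) summable_on UNIV"
      by (rule norm_summable_imp_summable_on) (use summable_abs_double_sum tail_zeta2_nonneg in simp)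
  qed auto
  then have summ: "?g summable_on Sigma UNIV (\<lambda>j. {j<..})"
    by (rule abs_summable_summable)
  have "(?g has_sum infsum ?g (Sigma UNIV (\<lambda>j. {j<..}))) (Sigma UNIV (\<lambda>j. {j<..}))"
    using summ by simp
  then have "((\<lambda>j. (-1) ^ j / (2 * real j + 1)\<^sup>2 * tail_zeta2 j) has_sum infsum ?g (Sigma UNIV (\<lambda>j. {j<..}))) UNIV"
    by (rule has_sum_SigmaD) (use inner in simp)
  then have "(\<lambda>j. (-1) ^ j / (2 * real j + 1)\<^sup>2 * tail_zeta2 j) sums infsum ?g (Sigma UNIV (\<lambda>j. {j<..}))"
    by (rule has_sum_imp_sums)
  then show ?thesis unfolding eqS double_sum_def by (simp add: sums_iff)
qed

section \<open>The positive part of a sum of three variables\<close>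

text \<open>Up to the factor \<open>pi\<close>, the mean of \<open>max 0 (s + U)\<close> for a variable \<open>U\<close> with density \<open>sech / pi\<close>.\<close>

definition positive_part_mean :: "real \<Rightarrow> ennreal" where
  "positive_part_mean s = (\<integral>\<^sup>+u. ennreal (max 0 (s + u)) * ennreal (sech u) \<partial>lborel)"

lemma borel_measurable_positive_part_mean [measurable]: "positive_part_mean \<in> borel_measurable borel"
  unfolding positive_part_mean_def[abs_def] by measurable

lemma positive_part_mean_neg:
  assumes "s > 0"
  shows "positive_part_mean (- s) = ennreal (excess s)"
proof -
  have "positive_part_mean (- s) = (\<integral>\<^sup>+u. ennreal (max 0 (- s + u) * sech u) \<partial>lborel)"
    unfolding positive_part_mean_def by (simp add: ennreal_mult' less_imp_le[OF sech_pos])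
  also have "\<dots> = ennreal \<bar>1\<bar> * (\<integral>\<^sup>+w. ennreal (max 0 (- s + (s + 1 * w)) * sech (s + 1 * w)) \<partial>lborel)"
    by (rule nn_integral_real_affine) auto
  also have "\<dots> = (\<integral>\<^sup>+w. ennreal (indicator {0<..} w * (w * sech (w + s))) \<partial>lborel)"
    by (simp, intro nn_integral_cong) (auto simp: add.commute split: split_indicator)
  also have "\<dots> = ennreal (excess s)"
    unfolding excess_def
    by (rule nn_integral_eq_integral[OF excess_series(1)[OF assms]])
       (auto simp: less_imp_le[OF sech_pos] split: split_indicator)
  finally show ?thesis .
qed

lemma positive_part_mean_reflect:
  "positive_part_mean s = (\<integral>\<^sup>+u. ennreal (max 0 (s - u)) * ennreal (sech u) \<partial>lborel)"
proof -
  have "positive_part_mean s = ennreal \<bar>-1\<bar> *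
      (\<integral>\<^sup>+u. ennreal (max 0 (s + (0 + -1 * u))) * ennreal (sech (0 + -1 * u)) \<partial>lborel)"
    unfolding positive_part_mean_def by (rule nn_integral_real_affine) auto
  then show ?thesis by (simp add: sech_minus)
qed

text \<open>Reflection of \<open>u\<close> and \<open>max 0 t = t + max 0 (-t)\<close> combine to \<open>max 0 (s + u) + max 0 (s - u) = 2 s + max 0 (u - s) + max 0 (- u - s)\<close>. The doubled identity keeps every term nonnegative.\<close>

lemma positive_part_mean_pos:
  assumes s: "s > 0"
  shows "positive_part_mean s = ennreal (pi * s) + ennreal (excess s)"
proof -
  have "2 * positive_part_mean s = (\<integral>\<^sup>+u. (ennreal (max 0 (s + u)) + ennreal (max 0 (s - u))) * ennreal (sech u) \<partial>lborel)"
    unfolding mult_2 distrib_right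
    by (subst (2) positive_part_mean_reflect, unfold positive_part_mean_def, rule nn_integral_add[symmetric]) auto
  also have "\<dots> = (\<integral>\<^sup>+u. (ennreal (2 * s) + (ennreal (max 0 (- s + u)) + ennreal (max 0 (- s - u)))) * ennreal (sech u) \<partial>lborel)"
  proof (intro nn_integral_cong arg_cong2[where f = "(*)"] refl)
    fix u :: real
    have "max 0 (s + u) + max 0 (s - u) = 2 * s + (max 0 (- s + u) + max 0 (- s - u))"
      using s by (auto simp: max_def)
    then show "ennreal (max 0 (s + u)) + ennreal (max 0 (s - u))
        = ennreal (2 * s) + (ennreal (max 0 (- s + u)) + ennreal (max 0 (- s - u)))"
      using s by (simp add: ennreal_plus[symmetric] del: ennreal_plus)
  qed
  also have "\<dots> = (\<integral>\<^sup>+u. ennreal (2 * s) * ennreal (sech u) \<partial>lborel)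
      + ((\<integral>\<^sup>+u. ennreal (max 0 (- s + u)) * ennreal (sech u) \<partial>lborel)
         + (\<integral>\<^sup>+u. ennreal (max 0 (- s - u)) * ennreal (sech u) \<partial>lborel))"
    unfolding distrib_right by (simp add: nn_integral_add)
  also have "\<dots> = ennreal (2 * s) * (\<integral>\<^sup>+u. ennreal (sech u) \<partial>lborel) + (positive_part_mean (- s) + positive_part_mean (- s))"
    unfolding positive_part_mean_def[symmetric] positive_part_mean_reflect[symmetric] by (simp add: nn_integral_cmult)
  also have "\<dots> = 2 * (ennreal (pi * s) + ennreal (excess s))"
    using s by (simp add: nn_integral_sech positive_part_mean_neg mult_2 distrib_left ennreal_mult[symmetric]
        ennreal_plus[symmetric] excess_nonneg mult_ac del: ennreal_plus)
  finally have "2 * positive_part_mean s = 2 * (ennreal (pi * s) + ennreal (excess s))" .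
  then show ?thesis
    by (simp only: ennreal_mult_cancel_left) simp
qed

text \<open>The convolution square of \<open>sech\<close> is \<open>2 s / sinh s\<close>. As this is even, the integral is folded onto the positive half-line.\<close>

lemma convolve_sech:
  assumes [measurable]: "G \<in> borel_measurable borel"
  shows "(\<integral>\<^sup>+u. (\<integral>\<^sup>+v. G (u + v) * ennreal (sech v) \<partial>lborel) * ennreal (sech u) \<partial>lborel)
       = (\<integral>\<^sup>+s\<in>{0<..}. ennreal (2 * s / sinh s) * (G s + G (- s)) \<partial>lborel)"
proof -
  have "(\<integral>\<^sup>+u. (\<integral>\<^sup>+v. G (u + v) * ennreal (sech v) \<partial>lborel) * ennreal (sech u) \<partial>lborel)
      = (\<integral>\<^sup>+u. (\<integral>\<^sup>+s. G s * (ennreal (sech u) * ennreal (sech (s - u))) \<partial>lborel) \<partial>lborel)"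
  proof (rule nn_integral_cong)
    fix u
    have "(\<integral>\<^sup>+v. G (u + v) * ennreal (sech v) \<partial>lborel)
        = ennreal \<bar>1\<bar> * (\<integral>\<^sup>+s. G (u + (- u + 1 * s)) * ennreal (sech (- u + 1 * s)) \<partial>lborel)"
      by (rule nn_integral_real_affine) auto
    then show "(\<integral>\<^sup>+v. G (u + v) * ennreal (sech v) \<partial>lborel) * ennreal (sech u)
        = (\<integral>\<^sup>+s. G s * (ennreal (sech u) * ennreal (sech (s - u))) \<partial>lborel)"
      by (subst mult.commute) (simp add: nn_integral_cmult[symmetric] mult_ac)
  qed
  also have "\<dots> = (\<integral>\<^sup>+s. (\<integral>\<^sup>+u. G s * (ennreal (sech u) * ennreal (sech (s - u))) \<partial>lborel) \<partial>lborel)"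
    by (rule lborel_pair.Fubini') measurable
  also have "\<dots> = (\<integral>\<^sup>+s. G s * ennreal (2 * s / sinh s) \<partial>lborel)"
  proof (rule nn_integral_cong_AE)
    show "AE s in lborel. (\<integral>\<^sup>+u. G s * (ennreal (sech u) * ennreal (sech (s - u))) \<partial>lborel) = G s * ennreal (2 * s / sinh s)"
      using AE_lborel_singleton[of 0]
    proof eventually_elim
      case (elim s)
      then show ?case
        by (simp add: nn_integral_cmult ennreal_mult[symmetric] less_imp_le[OF sech_pos] sech_conv_integral)
    qed
  qed
  also have "\<dots> = (\<integral>\<^sup>+s. G s * ennreal (2 * s / sinh s) * indicator {0<..} s
      + G s * ennreal (2 * s / sinh s) * indicator {..<0} s \<partial>lborel)"
  proof (rule nn_integral_cong_AE)
    show "AE s in lborel. G s * ennreal (2 * s / sinh s) = G s * ennreal (2 * s / sinh s) * indicator {0<..} s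
      + G s * ennreal (2 * s / sinh s) * indicator {..<0} s"
      using AE_lborel_singleton[of 0]
    proof eventually_elim
      case (elim s)
      then show ?case by (cases "s > 0") auto
    qed
  qed
  also have "\<dots> = (\<integral>\<^sup>+s. G s * ennreal (2 * s / sinh s) * indicator {0<..} s \<partial>lborel)
      + (\<integral>\<^sup>+s. G s * ennreal (2 * s / sinh s) * indicator {..<0} s \<partial>lborel)"
    by (rule nn_integral_add) auto
  also have "(\<integral>\<^sup>+s. G s * ennreal (2 * s / sinh s) * indicator {..<0} s \<partial>lborel)
      = ennreal \<bar>-1\<bar> * (\<integral>\<^sup>+s. G (0 + -1 * s) * ennreal (2 * (0 + -1 * s) / sinh (0 + -1 * s)) * indicator {..<0} (0 + -1 * s) \<partial>lborel)"
    by (rule nn_integral_real_affine) auto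
  also have "\<dots> = (\<integral>\<^sup>+s. G (- s) * ennreal (2 * s / sinh s) * indicator {0<..} s \<partial>lborel)"
    by (simp, intro nn_integral_cong) (auto split: split_indicator)
  also have "(\<integral>\<^sup>+s. G s * ennreal (2 * s / sinh s) * indicator {0<..} s \<partial>lborel) + \<dots>
      = (\<integral>\<^sup>+s\<in>{0<..}. ennreal (2 * s / sinh s) * (G s + G (- s)) \<partial>lborel)"
    by (subst nn_integral_add[symmetric]) (auto simp: algebra_simps)
  finally show ?thesis .
qed

text \<open>Up to the factor \<open>pi ^ 3\<close>, the mean of the positive part of the sum of three independent variables with density \<open>sech / pi\<close>.\<close>

definition triple_positive_part :: ennreal where
  "triple_positive_part =
     (\<integral>\<^sup>+u. (\<integral>\<^sup>+v. (\<integral>\<^sup>+w. ennreal (max 0 (u + v + w)) * ennreal (sech w) \<partial>lborel)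
        * ennreal (sech v) \<partial>lborel) * ennreal (sech u) \<partial>lborel)"

lemma triple_positive_part_eq:
  "triple_positive_part = ennreal (7 * pi * zeta 3) + 4 * ennreal double_sum"
proof -
  have "triple_positive_part = (\<integral>\<^sup>+s\<in>{0<..}. ennreal (2 * s / sinh s) * (positive_part_mean s + positive_part_mean (- s)) \<partial>lborel)"
    unfolding triple_positive_part_def positive_part_mean_def[symmetric]
    by (rule convolve_sech) measurable
  also have "\<dots> = (\<integral>\<^sup>+s. ennreal (2 * pi) * (ennreal (s ^ 2 / sinh s) * indicator {0<..} s)
      + 4 * (ennreal (s / sinh s * excess s) * indicator {0<..} s) \<partial>lborel)"
  proof (rule nn_integral_cong)
    fix s :: real
    show "ennreal (2 * s / sinh s) * (positive_part_mean s + positive_part_mean (- s)) * indicator {0<..} s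
        = ennreal (2 * pi) * (ennreal (s ^ 2 / sinh s) * indicator {0<..} s)
          + 4 * (ennreal (s / sinh s * excess s) * indicator {0<..} s)"
    proof (cases "s > 0")
      case True
      have "ennreal (2 * s / sinh s) * (positive_part_mean s + positive_part_mean (- s))
          = ennreal (2 * s / sinh s * (pi * s + excess s + excess s))"
      proof -
        have "positive_part_mean s + positive_part_mean (- s) = ennreal (pi * s + excess s + excess s)"
          using True excess_nonneg[of s] by (simp only: positive_part_mean_pos positive_part_mean_neg
              ennreal_plus add_nonneg_nonneg mult_nonneg_nonneg pi_ge_zero less_imp_le)
        then show ?thesis
          using True by (simp only:) (rule ennreal_mult'[symmetric], simp)
      qed
      also have "2 * s / sinh s * (pi * s + excess s + excess s)
          = 2 * pi * (s ^ 2 / sinh s) + 4 * (s / sinh s * excess s)"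
        using True by (simp add: field_simps power2_eq_square)
      also have "ennreal \<dots> = ennreal (2 * pi) * ennreal (s ^ 2 / sinh s) + 4 * ennreal (s / sinh s * excess s)"
      proof -
        have "ennreal (c * x + 4 * y) = ennreal c * ennreal x + 4 * ennreal y"
          if "c \<ge> 0" "x \<ge> 0" "y \<ge> 0" for c x y
          using that by (simp add: ennreal_mult)
        from this[of "2 * pi" "s ^ 2 / sinh s" "s / sinh s * excess s"] show ?thesis
          using True excess_nonneg[of s] by (simp only: mult_nonneg_nonneg divide_nonneg_nonneg pi_ge_zero
              less_imp_le sinh_real_nonneg_iff zero_le_power2 zero_le_numeral)
      qed
      finally show ?thesis using True by simp
    qed simp
  qed
  also have "\<dots> = ennreal (2 * pi) * ennreal (7 / 2 * zeta 3) + 4 * ennreal double_sum"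
    by (subst nn_integral_add, measurable, (subst nn_integral_cmult, measurable)+)
       (simp only: nn_integral_csch_square nn_integral_csch_excess)
  also have "ennreal (2 * pi) * ennreal (7 / 2 * zeta 3) = ennreal (7 * pi * zeta 3)"
    by (subst ennreal_mult'[symmetric]) (simp_all add: mult_ac)
  finally show ?thesis .
qed

section \<open>Integration over the torus\<close>

definition plus_prod :: "real \<Rightarrow> real \<Rightarrow> real \<Rightarrow> complex" where
  "plus_prod a b c = (1 + cis a) * (1 + cis b) * (1 + cis c)"
definition minus_prod :: "real \<Rightarrow> real \<Rightarrow> real \<Rightarrow> complex" where
  "minus_prod a b c = (1 - cis a) * (1 - cis b) * (1 - cis c)"

text \<open>Minus the logarithm of half the chord \<open>|1 + cis a|\<close>: a nonnegative substitute for \<open>ln |1 + cis a|\<close>, because a chord is at most 2.\<close>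

definition half_chord_log :: "real \<Rightarrow> real" where
  "half_chord_log a = ln 2 - ln (cmod (1 + cis a))"

text \<open>Excludes the finitely many directions in which one of the factors of the polynomial vanishes and the logarithms lose their additivity.\<close>

lemma AE_generic_angle: "AE a in lborel. 1 + cis a \<noteq> 0 \<and> 1 - cis a \<noteq> 0"
  using AE_cis_neq[of "-1"] AE_cis_neq[of 1]
  by eventually_elim (auto simp: add_eq_0_iff)

lemma norm_one_minus_cis_le: "cmod (1 - cis a) \<le> 2"
  using norm_triangle_ineq4[of 1 "cis a"] by simp

lemma half_chord_log_nonneg:
  assumes "1 + cis a \<noteq> 0" shows "half_chord_log a \<ge> 0"
  using norm_one_plus_cis_mult_le[of 1 a] assms by (simp add: half_chord_log_def)

lemma borel_measurable_half_chord_log [measurable]: "half_chord_log \<in> borel_measurable borel"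
  unfolding half_chord_log_def by measurable

lemma nn_integral_half_chord_log: "(\<integral>\<^sup>+a\<in>{0..2*pi}. ennreal (half_chord_log a) \<partial>lborel) = ennreal (2 * pi * ln 2)"
  using nn_jensen_unit_disc[of 1] by (simp add: half_chord_log_def)

definition torus_integral :: "(real \<Rightarrow> ennreal) \<Rightarrow> ennreal" where
  "torus_integral F = (\<integral>\<^sup>+a\<in>{0..2*pi}. F a \<partial>lborel)"

lemma torus_integral_cong_AE:
  "(AE a in lborel. F a = G a) \<Longrightarrow> torus_integral F = torus_integral G"
  unfolding torus_integral_def by (intro nn_integral_cong_AE) auto

lemma torus_integral_add:
  "F \<in> borel_measurable borel \<Longrightarrow> G \<in> borel_measurable borel \<Longrightarrow>
   torus_integral (\<lambda>a. F a + G a) = torus_integral F + torus_integral G"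
  unfolding torus_integral_def by (subst nn_integral_add[symmetric]) (auto simp: distrib_right)

lemma torus_integral_cmult:
  "F \<in> borel_measurable borel \<Longrightarrow> torus_integral (\<lambda>a. c * F a) = c * torus_integral F"
  unfolding torus_integral_def by (subst nn_integral_cmult[symmetric]) (auto simp: mult.assoc)

lemma torus_integral_const: "torus_integral (\<lambda>a. c) = c * ennreal (2 * pi)"
  unfolding torus_integral_def by (subst nn_integral_cmult_indicator) auto

lemma measurable_torus_integral [measurable (raw)]:
  assumes [measurable]: "case_prod F \<in> borel_measurable (M \<Otimes>\<^sub>M borel)"
  shows "(\<lambda>x. torus_integral (F x)) \<in> borel_measurable M"
  unfolding torus_integral_def by measurable

lemma torus_integral_log_tan:
  "F \<in> borel_measurable borel \<Longrightarrow>
   torus_integral (\<lambda>a. F (log_tan a)) = 2 * (\<integral>\<^sup>+u. F u * ennreal (sech u) \<partial>lborel)"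
  unfolding torus_integral_def by (rule nn_integral_log_tan)

text \<open>Each angle contributes a factor 2 from \<open>nn_integral_log_tan\<close>.\<close>

lemma torus_integral_positive_part:
  "torus_integral (\<lambda>a. torus_integral (\<lambda>b. torus_integral (\<lambda>c.
     ennreal (max 0 (log_tan a + log_tan b + log_tan c))))) = 8 * triple_positive_part"
proof -
  define G1 where "G1 s = (\<integral>\<^sup>+w. ennreal (max 0 (s + w)) * ennreal (sech w) \<partial>lborel)" for s
  define G2 where "G2 s = (\<integral>\<^sup>+v. G1 (s + v) * ennreal (sech v) \<partial>lborel)" for s
  have [measurable]: "G1 \<in> borel_measurable borel" unfolding G1_def[abs_def] by measurable
  have [measurable]: "G2 \<in> borel_measurable borel" unfolding G2_def[abs_def] by measurable
  have 1: "torus_integral (\<lambda>c. ennreal (max 0 (s + log_tan c))) = 2 * G1 s" for s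
    unfolding G1_def by (rule torus_integral_log_tan) measurable
  have 2: "torus_integral (\<lambda>b. 2 * G1 (s + log_tan b)) = 2 * (2 * G2 s)" for s
    unfolding G2_def
    by (subst torus_integral_cmult, measurable) (subst torus_integral_log_tan[of "\<lambda>v. G1 (s + v)"], auto)
  have 3: "torus_integral (\<lambda>a. 2 * (2 * G2 (log_tan a))) = 2 * (2 * (2 * (\<integral>\<^sup>+u. G2 u * ennreal (sech u) \<partial>lborel)))"
    by (subst torus_integral_cmult, measurable)+ (subst torus_integral_log_tan[of G2], auto)
  show ?thesis
    unfolding 1 2 3 triple_positive_part_def G1_def[symmetric] G2_def[symmetric]
    by (simp add: mult.assoc[symmetric])
qed

lemma log_max_prods:
  assumes "1 + cis a \<noteq> 0 \<and> 1 - cis a \<noteq> 0" "1 + cis b \<noteq> 0 \<and> 1 - cis b \<noteq> 0" "1 + cis c \<noteq> 0 \<and> 1 - cis c \<noteq> 0"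
  shows "max (ln (cmod (plus_prod a b c))) (ln (cmod (minus_prod a b c)))
       = 3 * ln 2 - (half_chord_log a + half_chord_log b + half_chord_log c) + max 0 (log_tan a + log_tan b + log_tan c)"
    and "max (ln (cmod (plus_prod a b c))) (ln (cmod (minus_prod a b c))) \<le> 3 * ln 2"
    and "plus_prod a b c \<noteq> 0" "minus_prod a b c \<noteq> 0"
proof -
  let ?p = "\<lambda>t. ln (cmod (1 + cis t))" and ?q = "\<lambda>t. ln (cmod (1 - cis t))"
  have n: "ln (cmod (plus_prod a b c)) = ?p a + ?p b + ?p c"
    using assms by (simp add: plus_prod_def norm_mult ln_mult)
  have d: "ln (cmod (minus_prod a b c)) = ?q a + ?q b + ?q c"
    using assms by (simp add: minus_prod_def norm_mult ln_mult)
  show "max (ln (cmod (plus_prod a b c))) (ln (cmod (minus_prod a b c)))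
       = 3 * ln 2 - (half_chord_log a + half_chord_log b + half_chord_log c) + max 0 (log_tan a + log_tan b + log_tan c)"
    unfolding n d half_chord_log_def log_tan_def by (simp add: max_def)
  have "?p t \<le> ln 2 \<and> ?q t \<le> ln 2" if "1 + cis t \<noteq> 0 \<and> 1 - cis t \<noteq> 0" for t
    using that norm_one_plus_cis_mult_le[of 1 t] norm_one_minus_cis_le[of t] by simp
  from this[OF assms(1)] this[OF assms(2)] this[OF assms(3)]
  show "max (ln (cmod (plus_prod a b c))) (ln (cmod (minus_prod a b c))) \<le> 3 * ln 2"
    unfolding n d by simp
  show "plus_prod a b c \<noteq> 0" "minus_prod a b c \<noteq> 0" using assms by (simp_all add: plus_prod_def minus_prod_def)
qed

text \<open>Integration over the last variable by Jensen's formula. The equation is arranged without subtraction, so that both sides can be integrated as nonnegative functions.\<close>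

lemma jensen_fibre:
  assumes "1 + cis a \<noteq> 0 \<and> 1 - cis a \<noteq> 0" "1 + cis b \<noteq> 0 \<and> 1 - cis b \<noteq> 0" "1 + cis c \<noteq> 0 \<and> 1 - cis c \<noteq> 0"
  shows "torus_integral (\<lambda>t. ennreal (4 * ln 2 - ln (cmod (plus_prod a b c + minus_prod a b c * cis t))))
         + ennreal (2 * pi) * ennreal (max 0 (log_tan a + log_tan b + log_tan c))
       = ennreal (2 * pi) * (ennreal (ln 2) + ennreal (half_chord_log a) + ennreal (half_chord_log b) + ennreal (half_chord_log c))"
proof -
  let ?m = "max (ln (cmod (plus_prod a b c))) (ln (cmod (minus_prod a b c)))"
  let ?P = "max 0 (log_tan a + log_tan b + log_tan c)"
  note l = log_max_prods[OF assms]
  have h: "half_chord_log a \<ge> 0" "half_chord_log b \<ge> 0" "half_chord_log c \<ge> 0"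
    using assms by (auto intro: half_chord_log_nonneg)
  have "torus_integral (\<lambda>t. ennreal (4 * ln 2 - ln (cmod (plus_prod a b c + minus_prod a b c * cis t))))
      = ennreal (2 * pi * (4 * ln 2 - ?m))"
    unfolding torus_integral_def using l by (intro nn_jensen_linear) auto
  also have "\<dots> = ennreal (2 * pi) * ennreal (4 * ln 2 - ?m)"
    by (rule ennreal_mult') simp
  also have "\<dots> + ennreal (2 * pi) * ennreal ?P = ennreal (2 * pi) * ennreal (4 * ln 2 - ?m + ?P)"
  proof -
    have "4 * ln 2 - ?m \<ge> 0" using l(2) ln_gt_zero[of "2::real"] by linarith
    then show ?thesis unfolding distrib_left[symmetric] by (subst ennreal_plus) auto
  qed
  also have "4 * ln 2 - ?m + ?P = ln 2 + half_chord_log a + half_chord_log b + half_chord_log c"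
    unfolding l(1) by simp
  also have "ennreal \<dots> = ennreal (ln 2) + ennreal (half_chord_log a) + ennreal (half_chord_log b) + ennreal (half_chord_log c)"
    using h by simp
  finally show ?thesis .
qed

text \<open>The integral of \<open>4 ln 2 - ln |P|\<close> over the torus. The right-hand side of \<open>jensen_fibre\<close> integrates to \<open>(2 pi)^4 * 4 ln 2\<close>, because each \<open>half_chord_log\<close> has mean \<open>ln 2\<close>.\<close>

lemma torus_integral_deficit:
  "torus_integral (\<lambda>a. torus_integral (\<lambda>b. torus_integral (\<lambda>c. torus_integral (\<lambda>t.
      ennreal (4 * ln 2 - ln (cmod (plus_prod a b c + minus_prod a b c * cis t)))))))
    + ennreal (16 * pi) * triple_positive_part = ennreal ((2 * pi) ^ 4 * (4 * ln 2))"
    (is "?I + _ = _")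
proof -
  have [measurable]: "(\<lambda>p. plus_prod (f p) (g p) (h p)) \<in> borel_measurable M" "(\<lambda>p. minus_prod (f p) (g p) (h p)) \<in> borel_measurable M"
    if [measurable]: "f \<in> borel_measurable M" "g \<in> borel_measurable M" "h \<in> borel_measurable M"
    for f g h and M :: "'x measure"
    unfolding plus_prod_def minus_prod_def by measurable
  define J where "J a b c = torus_integral (\<lambda>t. ennreal (4 * ln 2 - ln (cmod (plus_prod a b c + minus_prod a b c * cis t))))" for a b c
  define L where "L a b c = ennreal (2 * pi) * ennreal (max 0 (log_tan a + log_tan b + log_tan c))" for a b c
  define R where "R a b c = ennreal (2 * pi) * (ennreal (ln 2) + ennreal (half_chord_log a) + ennreal (half_chord_log b) + ennreal (half_chord_log c))" for a b c
  have [measurable]: "(\<lambda>p. J (f p) (g p) (h p)) \<in> borel_measurable M" "(\<lambda>p. L (f p) (g p) (h p)) \<in> borel_measurable M"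
    if [measurable]: "f \<in> borel_measurable M" "g \<in> borel_measurable M" "h \<in> borel_measurable M"
    for f g h and M :: "'x measure"
    unfolding J_def L_def by measurable
  have "torus_integral (\<lambda>a. torus_integral (\<lambda>b. torus_integral (\<lambda>c. J a b c)))
      + torus_integral (\<lambda>a. torus_integral (\<lambda>b. torus_integral (\<lambda>c. L a b c)))
      = torus_integral (\<lambda>a. torus_integral (\<lambda>b. torus_integral (\<lambda>c. J a b c + L a b c)))"
    by (simp add: torus_integral_add)
  also have "\<dots> = torus_integral (\<lambda>a. torus_integral (\<lambda>b. torus_integral (\<lambda>c. R a b c)))"
  proof (intro torus_integral_cong_AE)
    show "AE a in lborel. torus_integral (\<lambda>b. torus_integral (\<lambda>c. J a b c + L a b c))
        = torus_integral (\<lambda>b. torus_integral (\<lambda>c. R a b c))"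
      using AE_generic_angle
    proof eventually_elim
      case a: (elim a)
      show ?case
      proof (intro torus_integral_cong_AE)
        show "AE b in lborel. torus_integral (\<lambda>c. J a b c + L a b c) = torus_integral (\<lambda>c. R a b c)"
          using AE_generic_angle
        proof eventually_elim
          case b: (elim b)
          show ?case
          proof (intro torus_integral_cong_AE)
            show "AE c in lborel. J a b c + L a b c = R a b c"
              using AE_generic_angle
              by eventually_elim (unfold J_def L_def R_def, rule jensen_fibre[OF a b])
          qed
        qed
      qed
    qed
  qed
  also have "\<dots> = ennreal ((2 * pi) ^ 4 * (4 * ln 2))"
  proof -
    have t: "torus_integral (\<lambda>a. ennreal (half_chord_log a)) = ennreal (2 * pi * ln 2)"
      unfolding torus_integral_def by (rule nn_integral_half_chord_log)
    have "torus_integral (\<lambda>a. torus_integral (\<lambda>b. torus_integral (\<lambda>c. R a b c)))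
        = ennreal (2 * pi) * (ennreal (ln 2) * ennreal (2 * pi) * ennreal (2 * pi) * ennreal (2 * pi)
          + ennreal (2 * pi * ln 2) * ennreal (2 * pi) * ennreal (2 * pi)
          + ennreal (2 * pi * ln 2) * ennreal (2 * pi) * ennreal (2 * pi)
          + ennreal (2 * pi * ln 2) * ennreal (2 * pi) * ennreal (2 * pi))"
      unfolding R_def
      by (simp add: torus_integral_cmult torus_integral_add torus_integral_const t distrib_right mult_ac,
          simp add: algebra_simps)
    also have "\<dots> = ennreal ((2 * pi) ^ 4 * (4 * ln 2))"
      by (simp add: ennreal_mult'[symmetric] ennreal_plus[symmetric] power4_eq_xxxx algebra_simps del: ennreal_plus)
    finally show ?thesis .
  qed
  finally have "torus_integral (\<lambda>a. torus_integral (\<lambda>b. torus_integral (\<lambda>c. J a b c)))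
      + torus_integral (\<lambda>a. torus_integral (\<lambda>b. torus_integral (\<lambda>c. L a b c))) = ennreal ((2 * pi) ^ 4 * (4 * ln 2))" .
  moreover have "torus_integral (\<lambda>a. torus_integral (\<lambda>b. torus_integral (\<lambda>c. L a b c)))
      = ennreal (2 * pi) * (8 * triple_positive_part)"
    unfolding L_def torus_integral_positive_part[symmetric] by (simp add: torus_integral_cmult)
  moreover have "ennreal (2 * pi) * (8 * triple_positive_part) = ennreal (16 * pi) * triple_positive_part"
  proof -
    have "ennreal (16 * pi) = ennreal (2 * pi) * ennreal 8"
      by (subst ennreal_mult'[symmetric]) simp_all
    then show ?thesis by (simp add: mult.assoc)
  qed
  ultimately show ?thesis unfolding J_def by simp
qed

section \<open>The Mahler measure\<close>

text \<open>Splits one circle off a product. \<open>C\<close> stands for the indicators of the coordinates that remain to be split off.\<close>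

lemma nn_integral_PiM_insert_torus:
  fixes G :: "('i \<Rightarrow> real) \<Rightarrow> real \<Rightarrow> ennreal"
  assumes I: "finite I" "i \<notin> I"
    and H: "H \<in> borel_measurable (PiM (insert i I) (\<lambda>_. lborel))"
    and G: "\<And>x. x \<in> space (PiM I (\<lambda>_. lborel)) \<Longrightarrow> G x \<in> borel_measurable borel"
    and eq: "\<And>x y. H (x(i := y)) = G x y * indicator {0..2*pi} y * C x"
  shows "(\<integral>\<^sup>+t. H t \<partial>PiM (insert i I) (\<lambda>_. lborel)) = (\<integral>\<^sup>+x. torus_integral (G x) * C x \<partial>PiM I (\<lambda>_. lborel))"
proof -
  interpret product_sigma_finite "\<lambda>_::'i. lborel :: real measure"
    by standard
  show ?thesis
    unfolding product_nn_integral_insert[OF I H]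
  proof (rule nn_integral_cong)
    fix x :: "'i \<Rightarrow> real" assume "x \<in> space (PiM I (\<lambda>_. lborel))"
    then have [measurable]: "G x \<in> borel_measurable borel" by (rule G)
    show "(\<integral>\<^sup>+y. H (x(i := y)) \<partial>lborel) = torus_integral (G x) * C x"
      unfolding eq torus_integral_def by (rule nn_integral_multc) measurable
  qed
qed

lemma nn_integral_PiM_4:
  assumes F [measurable]: "F \<in> borel_measurable (borel \<Otimes>\<^sub>M borel \<Otimes>\<^sub>M borel \<Otimes>\<^sub>M borel)"
  shows "(\<integral>\<^sup>+t. F (t 0, t 1, t 2, t 3) * indicator (PiE {..<4} (\<lambda>_. {0..2*pi})) t
            \<partial>PiM {..<4::nat} (\<lambda>_. lborel))
       = torus_integral (\<lambda>a. torus_integral (\<lambda>b. torus_integral (\<lambda>c. torus_integral (\<lambda>d. F (a, b, c, d)))))"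
proof -
  interpret product_sigma_finite "\<lambda>_::nat. lborel :: real measure"
    by standard
  let ?I = "\<lambda>x. indicator {0..2*pi} (x::real) :: ennreal"
  have ind: "indicator (PiE {..<4} (\<lambda>_. {0..2*pi})) t = ?I (t 3) * ?I (t 2) * ?I (t 1) * ?I (t 0)"
    if "t \<in> space (PiM {..<4::nat} (\<lambda>_. lborel))" for t
  proof -
    have lt: "i < 4 \<longleftrightarrow> i = 0 \<or> i = 1 \<or> i = 2 \<or> i = 3" for i :: nat by auto
    have "t \<in> extensional {..<4}" using that by (simp add: space_PiM PiE_def)
    then have "t \<in> PiE {..<4} (\<lambda>_. {0..2*pi}) \<longleftrightarrow>
        t 0 \<in> {0..2*pi} \<and> t 1 \<in> {0..2*pi} \<and> t 2 \<in> {0..2*pi} \<and> t 3 \<in> {0..2*pi}"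
      unfolding PiE_def Pi_def Int_iff mem_Collect_eq lessThan_iff lt by blast
    then show ?thesis
      by (simp only: indicator_def of_bool_conj[symmetric] conj_ac)
  qed
  have S: "{..<4} = insert 3 (insert 2 (insert 1 (insert 0 ({}::nat set))))" by auto
  have "(\<integral>\<^sup>+t. F (t 0, t 1, t 2, t 3) * indicator (PiE {..<4} (\<lambda>_. {0..2*pi})) t \<partial>PiM {..<4::nat} (\<lambda>_. lborel))
      = (\<integral>\<^sup>+t. F (t 0, t 1, t 2, t 3) * ?I (t 3) * (?I (t 2) * (?I (t 1) * ?I (t 0)))
          \<partial>PiM (insert 3 (insert 2 (insert 1 (insert (0::nat) {})))) (\<lambda>_. lborel))"
    unfolding S[symmetric] by (rule nn_integral_cong, subst ind, assumption) (simp only: mult_ac)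
  also have "\<dots> = (\<integral>\<^sup>+t. torus_integral (\<lambda>d. F (t 0, t 1, t 2, d)) * (?I (t 2) * (?I (t 1) * ?I (t 0)))
          \<partial>PiM (insert 2 (insert 1 (insert (0::nat) {}))) (\<lambda>_. lborel))"
    by (rule nn_integral_PiM_insert_torus) (simp_all, measurable)
  also have "\<dots> = (\<integral>\<^sup>+t. torus_integral (\<lambda>d. F (t 0, t 1, t 2, d)) * ?I (t 2) * (?I (t 1) * ?I (t 0))
          \<partial>PiM (insert 2 (insert 1 (insert (0::nat) {}))) (\<lambda>_. lborel))"
    by (simp only: mult.assoc)
  also have "\<dots> = (\<integral>\<^sup>+t. torus_integral (\<lambda>c. torus_integral (\<lambda>d. F (t 0, t 1, c, d))) * (?I (t 1) * ?I (t 0))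
          \<partial>PiM (insert 1 (insert (0::nat) {})) (\<lambda>_. lborel))"
    by (rule nn_integral_PiM_insert_torus) (simp_all, measurable)
  also have "\<dots> = (\<integral>\<^sup>+t. torus_integral (\<lambda>c. torus_integral (\<lambda>d. F (t 0, t 1, c, d))) * ?I (t 1) * ?I (t 0)
          \<partial>PiM (insert 1 (insert (0::nat) {})) (\<lambda>_. lborel))"
    by (simp only: mult.assoc)
  also have "\<dots> = (\<integral>\<^sup>+t. torus_integral (\<lambda>b. torus_integral (\<lambda>c. torus_integral (\<lambda>d. F (t 0, b, c, d)))) * ?I (t 0)
          \<partial>PiM {0::nat} (\<lambda>_. lborel))"
    by (rule nn_integral_PiM_insert_torus) (simp_all, measurable)
  also have "\<dots> = torus_integral (\<lambda>a. torus_integral (\<lambda>b. torus_integral (\<lambda>c. torus_integral (\<lambda>d. F (a, b, c, d)))))"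
    unfolding torus_integral_def[of "\<lambda>a. torus_integral (\<lambda>b. torus_integral (\<lambda>c. torus_integral (\<lambda>d. F (a, b, c, d))))"]
    by (rule product_nn_integral_singleton[of _ 0]) measurable
  finally show ?thesis .
qed

text \<open>Passage from the nonnegative integral of \<open>K - g\<close> to the Bochner integral of \<open>g\<close>: its finite value yields the integrability of \<open>g\<close>.\<close>

lemma set_integral_torus_4:
  fixes g :: "real \<times> real \<times> real \<times> real \<Rightarrow> real"
  assumes g [measurable]: "g \<in> borel_measurable (borel \<Otimes>\<^sub>M borel \<Otimes>\<^sub>M borel \<Otimes>\<^sub>M borel)"
    and le: "\<And>p. g p \<le> K"
    and fin: "torus_integral (\<lambda>a. torus_integral (\<lambda>b. torus_integral (\<lambda>c. torus_integral (\<lambda>d.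
           ennreal (K - g (a, b, c, d)))))) = ennreal r" and r: "r \<ge> 0" and K: "K \<ge> 0"
  shows "(LINT t : PiE {..<4} (\<lambda>_. {0..2 * pi}) | PiM {..<4::nat} (\<lambda>_. lborel). g (t 0, t 1, t 2, t 3))
       = (2 * pi) ^ 4 * K - r"
proof -
  let ?M = "PiM {..<4::nat} (\<lambda>_. lborel :: real measure)"
  let ?S = "PiE {..<4} (\<lambda>_. {0..2 * pi}) :: (nat \<Rightarrow> real) set"
  let ?g = "\<lambda>t :: nat \<Rightarrow> real. g (t 0, t 1, t 2, t 3)"
  have [measurable]: "?S \<in> sets ?M"
    by (rule sets_PiM_I_finite) auto
  have gm [measurable]: "?g \<in> borel_measurable ?M" by measurable
  have c: "has_bochner_integral ?M (\<lambda>t. indicator ?S t * K) ((2 * pi) ^ 4 * K)"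
  proof (rule has_bochner_integral_nn_integral)
    have "(\<integral>\<^sup>+t. ennreal (indicator ?S t * K) \<partial>?M) = (\<integral>\<^sup>+t. ennreal K * indicator ?S t \<partial>?M)"
      by (intro nn_integral_cong) (auto split: split_indicator)
    also have "\<dots> = torus_integral (\<lambda>a. torus_integral (\<lambda>b. torus_integral (\<lambda>c. torus_integral (\<lambda>d. ennreal K))))"
      by (rule nn_integral_PiM_4[of "\<lambda>_. ennreal K"]) simp
    also have "\<dots> = ennreal ((2 * pi) ^ 4 * K)"
      using K by (simp only: torus_integral_const) (simp add: ennreal_mult'[symmetric] power4_eq_xxxx mult_ac)
    finally show "(\<integral>\<^sup>+t. ennreal (indicator ?S t * K) \<partial>?M) = ennreal ((2 * pi) ^ 4 * K)" .
  qed (use K in auto)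
  have h: "has_bochner_integral ?M (\<lambda>t. indicator ?S t * (K - ?g t)) r"
  proof (rule has_bochner_integral_nn_integral)
    have "(\<integral>\<^sup>+t. ennreal (indicator ?S t * (K - ?g t)) \<partial>?M) = (\<integral>\<^sup>+t. ennreal (K - ?g t) * indicator ?S t \<partial>?M)"
      by (intro nn_integral_cong) (auto split: split_indicator)
    also have "\<dots> = torus_integral (\<lambda>a. torus_integral (\<lambda>b. torus_integral (\<lambda>c. torus_integral (\<lambda>d.
           ennreal (K - g (a, b, c, d))))))"
      by (rule nn_integral_PiM_4[of "\<lambda>p. ennreal (K - g p)"]) measurable
    finally show "(\<integral>\<^sup>+t. ennreal (indicator ?S t * (K - ?g t)) \<partial>?M) = ennreal r" unfolding fin .
  qed (use r le in \<open>auto split: split_indicator\<close>)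
  have "has_bochner_integral ?M (\<lambda>t. indicator ?S t * K - indicator ?S t * (K - ?g t)) ((2 * pi) ^ 4 * K - r)"
    by (rule has_bochner_integral_diff[OF c h])
  also have "(\<lambda>t. indicator ?S t * K - indicator ?S t * (K - ?g t)) = (\<lambda>t. indicator ?S t *\<^sub>R ?g t)"
    by (auto simp: algebra_simps)
  finally show ?thesis
    unfolding set_lebesgue_integral_def by (rule has_bochner_integral_integral_eq)
qed

theorem mainTheorem9:
  "pi ^ 3 * mahler_measure 4
      (let v = Var 0; w = Var 1; x = Var 2; y = Var 3
       in (1 + v) * (1 + w) * (1 + x) + (1 - v) * (1 - w) * (1 - x) * y)
   = 7 * pi * zeta 3
     + 4 * (\<Sum>\<^sub>\<infinity>(j, k) \<in> {(j, k). j < k}.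
              (-1) ^ j / ((2 * real j + 1)\<^sup>2 * (real k)\<^sup>2))"
proof -
  define g where "g = (\<lambda>(a, b, c, d). ln (cmod (plus_prod a b c + minus_prod a b c * cis d)))"
  define D where "D = 7 * pi * zeta 3 + 4 * double_sum"
  have zeta_nonneg: "zeta 3 \<ge> 0"
    unfolding zeta_def
    by (intro suminf_nonneg) (use summable_inverse_power_Suc[of 3] in \<open>simp_all add: powr_numeral\<close>)
  have D: "D \<ge> 0" "triple_positive_part = ennreal D"
    unfolding triple_positive_part_eq D_def using zeta_nonneg double_sum_nonneg
    by (simp_all add: ennreal_mult')
  have gm: "g \<in> borel_measurable (borel \<Otimes>\<^sub>M borel \<Otimes>\<^sub>M borel \<Otimes>\<^sub>M borel)"
    unfolding g_def plus_prod_def minus_prod_def by measurable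
  have le: "g p \<le> 4 * ln 2" for p
  proof -
    obtain a b c d where p: "p = (a, b, c, d)" by (cases p)
    let ?z = "plus_prod a b c + minus_prod a b c * cis d"
    have n: "cmod (plus_prod a b c) \<le> 2 * 2 * 2"
      unfolding plus_prod_def norm_mult using norm_one_plus_cis_mult_le[of 1] by (intro mult_mono) auto
    have m: "cmod (minus_prod a b c) \<le> 2 * 2 * 2"
      unfolding minus_prod_def norm_mult by (intro mult_mono norm_one_minus_cis_le) auto
    have "cmod ?z \<le> 16"
      using norm_triangle_ineq[of "plus_prod a b c" "minus_prod a b c * cis d"] n m by (simp add: norm_mult)
    moreover have "ln (16::real) = 4 * ln 2"
      using ln_realpow[of "2::real" 4] by simp
    ultimately show ?thesis
      unfolding p g_def using ln_mono[of "cmod ?z" 16] by (cases "?z = 0") auto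
  qed
  define T where "T = torus_integral (\<lambda>a. torus_integral (\<lambda>b. torus_integral (\<lambda>c. torus_integral (\<lambda>d.
           ennreal (4 * ln 2 - g (a, b, c, d))))))"
  have "T + ennreal (16 * pi * D) = ennreal ((2 * pi) ^ 4 * (4 * ln 2))"
    using torus_integral_deficit D unfolding T_def g_def by (simp add: ennreal_mult')
  then obtain q where q: "q \<ge> 0" "T = ennreal q" "ennreal q + ennreal (16 * pi * D) = ennreal ((2 * pi) ^ 4 * (4 * ln 2))"
    by (cases T) auto
  then have "ennreal (q + 16 * pi * D) = ennreal ((2 * pi) ^ 4 * (4 * ln 2))"
    using D(1) by (subst ennreal_plus) simp_all
  then have "q + 16 * pi * D = (2 * pi) ^ 4 * (4 * ln 2)"
    using q(1) D(1) by (subst (asm) ennreal_inj) simp_all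
  then have q_eq: "q = (2 * pi) ^ 4 * (4 * ln 2) - 16 * pi * D" by simp
  have int: "(LINT t : PiE {..<4} (\<lambda>_. {0..2 * pi}) | PiM {..<4::nat} (\<lambda>_. lborel). g (t 0, t 1, t 2, t 3))
      = (2 * pi) ^ 4 * (4 * ln 2) - q"
    by (rule set_integral_torus_4[OF gm le _ q(1)]) (use q(2) in \<open>simp_all add: T_def\<close>)
  have "mahler_measure 4 (let v = Var 0; w = Var 1; x = Var 2; y = Var 3
       in (1 + v) * (1 + w) * (1 + x) + (1 - v) * (1 - w) * (1 - x) * y)
     = (LINT t : PiE {..<4} (\<lambda>_. {0..2 * pi}) | PiM {..<4::nat} (\<lambda>_. lborel). g (t 0, t 1, t 2, t 3)) / (2 * pi) ^ 4"
    unfolding mahler_measure_def Let_def eval_poly_add eval_poly_diff eval_poly_mult eval_poly_one eval_poly_Var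
      g_def plus_prod_def minus_prod_def by simp
  also have "\<dots> = 16 * pi * D / (2 * pi) ^ 4"
    unfolding int q_eq by (simp only: diff_diff_eq2 add_diff_cancel_left')
  also have "\<dots> = D / pi ^ 3"
    by (simp add: power_mult_distrib power_eq_if)
  finally show ?thesis
    by (simp add: D_def double_sum_infsum)
qed

end
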